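(* Let $d\ge 3$ be an integer and $\mu>0$. The Tangherlini metric $$g_T=-\left(1-\frac{\mu}{r^{d-2}}\right)dt^2+\frac{1}{1-\frac{\mu}{r^{d-2}}}\,dr^2+r^2 g_{S^{d-1}}$$ on the $(d+1)$-dimensional manifold $\{(t,r,\omega): t\in\mathbb{R},\ r>0,\ r^{d-2}\neq\mu,\ \omega\in S^{d-1}\}$ is Ricci-flat, i.e. its Ricci tensor vanishes identically.
   Context: $g_{S^{d-1}}$ denotes the standard round Riemannian metric on the unit sphere $S^{d-1}$. The metric $g_T$ is Lorentzian with signature $(-,+,\dots,+)$. *)

theory Defs
  imports "HOL-Analysis.Analysis"
begin

text \<open>
  Manifolds are embedded submanifolds \<open>M\<close> of a Euclidean space \<open>'e\<close>. A metric on \<open>M\<close> is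
  given by bilinear forms \<open>g p\<close> on \<open>'e\<close>, of which only the restrictions to the tangent
  spaces of \<open>M\<close> matter. Curvature is computed in local coordinates, that is, for pullbacks
  of \<open>g\<close> along smooth local parametrizations (inverses of charts).
\<close>

section \<open>Smooth maps, local parametrizations, submanifolds\<close>

text \<open>The following two notions are meant for open \<open>S\<close>.\<close>

primrec Ck_on :: "nat \<Rightarrow> 'a::euclidean_space set \<Rightarrow> ('a \<Rightarrow> 'b::euclidean_space) \<Rightarrow> bool" where
  "Ck_on 0 S f \<longleftrightarrow> continuous_on S f"
| "Ck_on (Suc k) S f \<longleftrightarrow>
     (\<forall>x\<in>S. f differentiable (at x)) \<and>
     (\<forall>v. Ck_on k S (\<lambda>x. frechet_derivative f (at x) v))"

definition smooth_map_on :: "'a::euclidean_space set \<Rightarrow> ('a \<Rightarrow> 'b::euclidean_space) \<Rightarrow> bool" where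
  "smooth_map_on S f \<longleftrightarrow> (\<forall>k. Ck_on k S f)"

definition local_parametrization ::
    "'e::euclidean_space set \<Rightarrow> (real ^ 'n) set \<Rightarrow> (real ^ 'n \<Rightarrow> 'e) \<Rightarrow> bool" where
  "local_parametrization M U \<phi> \<longleftrightarrow>
     open U \<and> smooth_map_on U \<phi> \<and>
     (\<forall>u\<in>U. inj (frechet_derivative \<phi> (at u))) \<and>
     openin (top_of_set M) (\<phi> ` U) \<and>
     (\<exists>\<psi>. homeomorphism U (\<phi> ` U) \<phi> \<psi>)"

definition smooth_submanifold :: "'n::finite itself \<Rightarrow> 'e::euclidean_space set \<Rightarrow> bool" where
  "smooth_submanifold TYPE('n) M \<longleftrightarrow>
     (\<forall>p\<in>M. \<exists>U (\<phi> :: real ^ 'n \<Rightarrow> 'e). local_parametrization M U \<phi> \<and> p \<in> \<phi> ` U)"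

section \<open>Ricci tensor in local coordinates\<close>

definition partial_deriv ::
    "'n::finite \<Rightarrow> (real ^ 'n \<Rightarrow> 'b::real_normed_vector) \<Rightarrow> real ^ 'n \<Rightarrow> 'b" where
  "partial_deriv i f u = frechet_derivative f (at u) (axis i 1)"

definition coord_metric ::
    "(real ^ 'n::finite \<Rightarrow> 'e::euclidean_space) \<Rightarrow> ('e \<Rightarrow> 'e \<Rightarrow> 'e \<Rightarrow> real)
      \<Rightarrow> real ^ 'n \<Rightarrow> real ^ 'n ^ 'n" where
  "coord_metric \<phi> g u = (\<chi> i j. g (\<phi> u) (partial_deriv i \<phi> u) (partial_deriv j \<phi> u))"

text \<open>\<open>christoffel G k i j\<close> is $\Gamma^k_{ij}$.\<close>

definition christoffel ::
    "(real ^ 'n \<Rightarrow> real ^ 'n ^ 'n) \<Rightarrow> 'n::finite \<Rightarrow> 'n \<Rightarrow> 'n \<Rightarrow> real ^ 'n \<Rightarrow> real" where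
  "christoffel G k i j u =
     (1/2) * (\<Sum>l\<in>UNIV. matrix_inv (G u) $ k $ l *
       (partial_deriv i (\<lambda>x. G x $ j $ l) u
        + partial_deriv j (\<lambda>x. G x $ i $ l) u
        - partial_deriv l (\<lambda>x. G x $ i $ j) u))"

text \<open>\<open>riemann G k l i j\<close> is $R^k{}_{lij}$, the \<open>k\<close>-th component of
  $R(\partial_i,\partial_j)\partial_l$.\<close>

definition riemann ::
    "(real ^ 'n \<Rightarrow> real ^ 'n ^ 'n) \<Rightarrow> 'n::finite \<Rightarrow> 'n \<Rightarrow> 'n \<Rightarrow> 'n \<Rightarrow> real ^ 'n \<Rightarrow> real" where
  "riemann G k l i j u =
     partial_deriv i (christoffel G k j l) u - partial_deriv j (christoffel G k i l) u
     + (\<Sum>m\<in>UNIV. christoffel G k i m u * christoffel G m j l u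
                  - christoffel G k j m u * christoffel G m i l u)"

definition ricci ::
    "(real ^ 'n \<Rightarrow> real ^ 'n ^ 'n) \<Rightarrow> 'n::finite \<Rightarrow> 'n \<Rightarrow> real ^ 'n \<Rightarrow> real" where
  "ricci G i j u = (\<Sum>k\<in>UNIV. riemann G k i k j u)"

text \<open>The first conjunct, that \<open>M\<close> is a \<open>CARD('n)\<close>-dimensional submanifold, ensures that the
  quantification over local coordinates reaches every point of \<open>M\<close>.\<close>

definition ricci_flat ::
    "'n::finite itself \<Rightarrow> 'e::euclidean_space set \<Rightarrow> ('e \<Rightarrow> 'e \<Rightarrow> 'e \<Rightarrow> real) \<Rightarrow> bool" where
  "ricci_flat TYPE('n) M g \<longleftrightarrow>
     smooth_submanifold TYPE('n) M \<and>
     (\<forall>U (\<phi> :: real ^ 'n \<Rightarrow> 'e). local_parametrization M U \<phi> \<longrightarrow>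
        (\<forall>u\<in>U. \<forall>i j. ricci (coord_metric \<phi> g) i j u = 0))"

section \<open>The Tangherlini metric\<close>

text \<open>Here $d$ is \<open>CARD('d)\<close>, the sphere $S^{d-1}$ is the unit sphere of \<open>real ^ 'd\<close>, and its
  round metric is the one induced by the Euclidean inner product.\<close>

definition round_metric :: "real ^ 'd::finite \<Rightarrow> real ^ 'd \<Rightarrow> real ^ 'd \<Rightarrow> real" where
  "round_metric \<omega> v w = v \<bullet> w"

definition tangherlini_manifold :: "real \<Rightarrow> (real \<times> real \<times> (real ^ 'd::finite)) set" where
  "tangherlini_manifold \<mu> =
     {(t, r, \<omega>). r > 0 \<and> r ^ (CARD('d) - 2) \<noteq> \<mu> \<and> \<omega> \<in> sphere 0 1}"

definition tangherlini_metric ::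
    "real \<Rightarrow> real \<times> real \<times> (real ^ 'd::finite) \<Rightarrow> real \<times> real \<times> (real ^ 'd)
      \<Rightarrow> real \<times> real \<times> (real ^ 'd) \<Rightarrow> real" where
  "tangherlini_metric \<mu> = (\<lambda>(t, r, \<omega>) (v_t, v_r, v_\<omega>) (w_t, w_r, w_\<omega>).
     - (1 - \<mu> / r ^ (CARD('d) - 2)) * (v_t * w_t)
     + 1 / (1 - \<mu> / r ^ (CARD('d) - 2)) * (v_r * w_r)
     + r\<^sup>2 * round_metric \<omega> v_\<omega> w_\<omega>)"

end

theory Submission
  imports Defs
begin

text \<open>
  On the ambient space \<open>real \<times> real \<times> real ^ 'd\<close> let \<open>A p X Y\<close> be symmetric and bilinear in
  \<open>X\<close> and \<open>Y\<close> such that the covariant derivative \<open>\<partial>\<^sub>X Y + A p X Y\<close> maps tangent fields of \<open>M\<close>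
  to tangent fields and is compatible with the metric. In every parametrization \<open>\<phi>\<close> of \<open>M\<close>,
  Koszul's formula then gives
  $\sum_k \Gamma^k_{ij} \partial_k\phi = \partial_i\partial_j\phi + A(\partial_i\phi, \partial_j\phi)$.
  Differentiating once more and antisymmetrizing, the third derivatives of \<open>\<phi>\<close> cancel and
  $\sum_k R^k{}_{lij} \partial_k\phi$ becomes an algebraic expression in \<open>A\<close>, its derivative and the
  tangent vectors. Hence the Ricci tensor in arbitrary coordinates is the trace of an explicit
  endomorphism of the tangent space, and no transformation rule for curvature is needed. For
  $-F dt^2 + F^{-1} dr^2 + r^2 g_{S^{d-1}}$ the trace vanishes if $F'' + (d-1) F'/r = 0$ and
  $(d-2)(1-F) = r F'$.
\<close>

section \<open>Smooth maps and symmetry of second derivatives\<close>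

text \<open>Two applications of the mean value theorem: first along \<open>v\<close> to the
  difference of \<open>f\<close> between two parallel sides of the parallelogram, then along
  \<open>w\<close> to \<open>fv\<close>.\<close>

lemma second_difference_mean_value:
  fixes f fv fvw :: "'a::real_normed_vector \<Rightarrow> real"
  assumes fv: "\<And>x. x \<in> S \<Longrightarrow> ((\<lambda>t. f (x + t *\<^sub>R v)) has_real_derivative fv x) (at 0)"
    and fvw: "\<And>x. x \<in> S \<Longrightarrow> ((\<lambda>t. fv (x + t *\<^sub>R w)) has_real_derivative fvw x) (at 0)"
    and S: "\<And>a b. \<lbrakk>0 \<le> a; a \<le> s; 0 \<le> b; b \<le> s\<rbrakk> \<Longrightarrow> u + a *\<^sub>R v + b *\<^sub>R w \<in> S"
    and s: "0 < s"
  obtains a b where "0 \<le> a" "a \<le> s" "0 \<le> b" "b \<le> s"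
    "f (u + s *\<^sub>R v + s *\<^sub>R w) - f (u + s *\<^sub>R v) - f (u + s *\<^sub>R w) + f u
       = s\<^sup>2 * fvw (u + a *\<^sub>R v + b *\<^sub>R w)"
proof -
  have shift: "((\<lambda>t. h (x + t *\<^sub>R z)) has_real_derivative D) (at t0)"
    if "((\<lambda>t. h (x + t0 *\<^sub>R z + t *\<^sub>R z)) has_real_derivative D) (at 0)"
    for h :: "'a \<Rightarrow> real" and x z D t0
    using DERIV_shift[of "\<lambda>t. h (x + t *\<^sub>R z)" D 0 t0] that
    by (simp add: algebra_simps)
  let ?g = "\<lambda>a. f (u + a *\<^sub>R v + s *\<^sub>R w) - f (u + a *\<^sub>R v)"
  let ?g' = "\<lambda>a. fv (u + a *\<^sub>R v + s *\<^sub>R w) - fv (u + a *\<^sub>R v)"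
  have g: "(?g has_real_derivative ?g' a) (at a)" if "0 \<le> a" "a \<le> s" for a
  proof -
    have 1: "((\<lambda>a. f (u + a *\<^sub>R v)) has_real_derivative fv (u + a *\<^sub>R v)) (at a)"
      by (rule shift, rule fv) (use S[of a 0] that s in auto)
    have "((\<lambda>a. f (u + s *\<^sub>R w + a *\<^sub>R v)) has_real_derivative fv (u + s *\<^sub>R w + a *\<^sub>R v)) (at a)"
      by (rule shift, rule fv) (use S[of a s] that s in \<open>auto simp: algebra_simps\<close>)
    then have 2: "((\<lambda>a. f (u + a *\<^sub>R v + s *\<^sub>R w)) has_real_derivative fv (u + a *\<^sub>R v + s *\<^sub>R w)) (at a)"
      by (simp add: algebra_simps)
    show ?thesis by (rule DERIV_diff[OF 2 1])
  qed
  obtain a where a: "0 < a" "a < s" "?g s - ?g 0 = (s - 0) * ?g' a"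
    using MVT2[OF s, of ?g ?g'] g by auto
  have h: "((\<lambda>b. fv (u + a *\<^sub>R v + b *\<^sub>R w)) has_real_derivative fvw (u + a *\<^sub>R v + b *\<^sub>R w)) (at b)"
    if "0 \<le> b" "b \<le> s" for b
    by (rule shift, rule fvw) (use S[of a b] that a in auto)
  obtain b where b: "0 < b" "b < s"
    "fv (u + a *\<^sub>R v + s *\<^sub>R w) - fv (u + a *\<^sub>R v + 0 *\<^sub>R w) = (s - 0) * fvw (u + a *\<^sub>R v + b *\<^sub>R w)"
    using MVT2[OF s, of "\<lambda>b. fv (u + a *\<^sub>R v + b *\<^sub>R w)" "\<lambda>b. fvw (u + a *\<^sub>R v + b *\<^sub>R w)"] h by auto
  show thesis
    using a b by (intro that[of a b]) (auto simp: power2_eq_square)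
qed

lemma directional_derivative:
  assumes "(f has_derivative f') (at x)"
  shows "((\<lambda>t. f (x + t *\<^sub>R v)) has_vector_derivative f' v) (at 0)"
proof -
  have "((\<lambda>t. x + t *\<^sub>R v) has_vector_derivative v) (at 0)"
    by (auto intro!: derivative_eq_intros simp: has_vector_derivative_def)
  moreover have "(f has_derivative f') (at (x + 0 *\<^sub>R v))"
    using assms by simp
  ultimately show ?thesis
    using vector_derivative_diff_chain_within[of "\<lambda>t. x + t *\<^sub>R v" v 0 UNIV f f']
    by (auto simp: o_def intro: has_derivative_at_withinI)
qed

text \<open>The second difference is symmetric in \<open>v\<close> and \<open>w\<close>, so it
  equals both \<open>s\<^sup>2\<close> times a value of \<open>fvw\<close> and
  \<open>s\<^sup>2\<close> times a value of \<open>fwv\<close> at points close to \<open>u\<close>.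
  By continuity the two limits cannot differ.\<close>

lemma mixed_directional_derivatives_real:
  fixes f fv fw fvw fwv :: "'a::real_normed_vector \<Rightarrow> real"
  assumes S: "open S" "u \<in> S"
    and fv: "\<And>x. x \<in> S \<Longrightarrow> ((\<lambda>t. f (x + t *\<^sub>R v)) has_real_derivative fv x) (at 0)"
    and fvw: "\<And>x. x \<in> S \<Longrightarrow> ((\<lambda>t. fv (x + t *\<^sub>R w)) has_real_derivative fvw x) (at 0)"
    and fw: "\<And>x. x \<in> S \<Longrightarrow> ((\<lambda>t. f (x + t *\<^sub>R w)) has_real_derivative fw x) (at 0)"
    and fwv: "\<And>x. x \<in> S \<Longrightarrow> ((\<lambda>t. fw (x + t *\<^sub>R v)) has_real_derivative fwv x) (at 0)"
    and cont: "continuous_on S fvw" "continuous_on S fwv"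
  shows "fvw u = fwv u"
proof (rule ccontr)
  assume "fvw u \<noteq> fwv u"
  define e where "e = \<bar>fvw u - fwv u\<bar> / 2"
  have e: "e > 0" using \<open>fvw u \<noteq> fwv u\<close> by (simp add: e_def)
  obtain d1 where d1: "d1 > 0" "\<And>x. x \<in> S \<Longrightarrow> dist x u < d1 \<Longrightarrow> dist (fvw x) (fvw u) < e"
    using cont(1) S(2) e unfolding continuous_on_iff by metis
  obtain d2 where d2: "d2 > 0" "\<And>x. x \<in> S \<Longrightarrow> dist x u < d2 \<Longrightarrow> dist (fwv x) (fwv u) < e"
    using cont(2) S(2) e unfolding continuous_on_iff by metis
  obtain d3 where d3: "d3 > 0" "ball u d3 \<subseteq> S"
    using S open_contains_ball by blast
  define d where "d = min d1 (min d2 d3)"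
  have d: "d > 0" using d1 d2 d3 by (simp add: d_def)
  \<comment> \<open>With this \<open>s\<close> the whole parallelogram with sides
    \<open>s *\<^sub>R v\<close> and \<open>s *\<^sub>R w\<close> stays within distance
    \<open>d\<close> of \<open>u\<close>. The summand 1 keeps the denominator positive when
    \<open>v\<close> and \<open>w\<close> vanish.\<close>
  define s where "s = d / (norm v + norm w + 1)"
  have pos: "norm v + norm w + 1 > 0"
    by (smt (verit) norm_ge_zero)
  have s: "s > 0" using d pos by (simp add: s_def)
  have near: "dist (u + a *\<^sub>R v + b *\<^sub>R w) u < d" if "0 \<le> a" "a \<le> s" "0 \<le> b" "b \<le> s" for a b
  proof -
    have "dist (u + a *\<^sub>R v + b *\<^sub>R w) u = norm (a *\<^sub>R v + b *\<^sub>R w)"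
      by (simp add: dist_norm algebra_simps)
    also have "\<dots> \<le> a * norm v + b * norm w"
      using norm_triangle_ineq[of "a *\<^sub>R v" "b *\<^sub>R w"] that by simp
    also have "\<dots> \<le> s * norm v + s * norm w"
      using that by (intro add_mono mult_right_mono) auto
    also have "\<dots> < s * (norm v + norm w + 1)"
      using s by (simp add: algebra_simps)
    also have "\<dots> = d" using pos by (simp add: s_def)
    finally show ?thesis .
  qed
  have inS: "u + a *\<^sub>R v + b *\<^sub>R w \<in> S" if "0 \<le> a" "a \<le> s" "0 \<le> b" "b \<le> s" for a b
    using near[OF that] d3 by (auto simp: d_def dist_commute)
  have inS': "u + a *\<^sub>R w + b *\<^sub>R v \<in> S" if "0 \<le> a" "a \<le> s" "0 \<le> b" "b \<le> s" for a b
    using inS[of b a] that by (simp add: algebra_simps)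
  obtain a b where ab: "0 \<le> a" "a \<le> s" "0 \<le> b" "b \<le> s"
    "f (u + s *\<^sub>R v + s *\<^sub>R w) - f (u + s *\<^sub>R v) - f (u + s *\<^sub>R w) + f u
       = s\<^sup>2 * fvw (u + a *\<^sub>R v + b *\<^sub>R w)"
    using second_difference_mean_value[of S f v fv w fvw s u, OF fv fvw inS s] by blast
  obtain a' b' where ab': "0 \<le> a'" "a' \<le> s" "0 \<le> b'" "b' \<le> s"
    "f (u + s *\<^sub>R w + s *\<^sub>R v) - f (u + s *\<^sub>R w) - f (u + s *\<^sub>R v) + f u
       = s\<^sup>2 * fwv (u + a' *\<^sub>R w + b' *\<^sub>R v)"
    using second_difference_mean_value[of S f w fw v fwv s u, OF fw fwv inS' s] by blast
  have comm: "u + s *\<^sub>R w + s *\<^sub>R v = u + s *\<^sub>R v + s *\<^sub>R w"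
    by simp
  have "s\<^sup>2 * fvw (u + a *\<^sub>R v + b *\<^sub>R w) = s\<^sup>2 * fwv (u + a' *\<^sub>R w + b' *\<^sub>R v)"
    using ab(5) ab'(5) unfolding comm by linarith
  then have eq: "fvw (u + a *\<^sub>R v + b *\<^sub>R w) = fwv (u + b' *\<^sub>R v + a' *\<^sub>R w)"
    using s by (simp add: algebra_simps)
  have "dist (fvw (u + a *\<^sub>R v + b *\<^sub>R w)) (fvw u) < e"
    using near[OF ab(1-4)] by (intro d1 inS ab) (simp add: d_def)
  moreover have "dist (fwv (u + b' *\<^sub>R v + a' *\<^sub>R w)) (fwv u) < e"
    using near[OF ab'(3,4,1,2)] by (intro d2 inS ab') (simp add: d_def)
  ultimately show False
    using eq unfolding e_def dist_real_def by argo
qed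

text \<open>Pairing with a basis vector of the target reduces the claim to real functions; order 2
  supplies continuity of both mixed derivatives.\<close>

lemma Ck_on_2_symmetric:
  fixes f :: "'a::euclidean_space \<Rightarrow> 'b::euclidean_space"
  assumes S: "open S" "x \<in> S" and f: "Ck_on 2 S f"
  shows "frechet_derivative (\<lambda>y. frechet_derivative f (at y) v) (at x) w
       = frechet_derivative (\<lambda>y. frechet_derivative f (at y) w) (at x) v"
proof (rule euclidean_eqI)
  fix b :: 'b
  assume "b \<in> Basis"
  let ?D = "\<lambda>v y. frechet_derivative f (at y) v"
  let ?DD = "\<lambda>v w y. frechet_derivative (?D v) (at y) w"
  have 1: "(f has_derivative (\<lambda>v. ?D v y)) (at y)" if "y \<in> S" for y
    using f that by (auto simp: numeral_2_eq_2 frechet_derivative_works)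
  have 2: "(?D v has_derivative (\<lambda>w. ?DD v w y)) (at y)" if "y \<in> S" for v y
    using f that by (auto simp: numeral_2_eq_2 frechet_derivative_works)
  have 3: "continuous_on S (\<lambda>y. ?DD v w y \<bullet> b)" for v w
    using f by (intro continuous_intros) (auto simp: numeral_2_eq_2)
  have 4: "((\<lambda>t. h (y + t *\<^sub>R v) \<bullet> b) has_real_derivative (h' v \<bullet> b)) (at 0)"
    if "(h has_derivative h') (at y)" for h :: "'a \<Rightarrow> 'b" and h' y v
    using directional_derivative[OF that, of v]
    unfolding has_vector_derivative_def has_field_derivative_def
    by (auto intro!: derivative_eq_intros simp: mult.commute)
  show "?DD v w x \<bullet> b = ?DD w v x \<bullet> b"
    by (rule mixed_directional_derivatives_real[OF S, of "\<lambda>y. f y \<bullet> b" v "\<lambda>y. ?D v y \<bullet> b" w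
        "\<lambda>y. ?DD v w y \<bullet> b" "\<lambda>y. ?D w y \<bullet> b" "\<lambda>y. ?DD w v y \<bullet> b"])
      (rule 3 4 1 2 | assumption)+
qed

section \<open>Closure properties of \<open>Ck_on\<close>\<close>

lemma Ck_on_cong:
  assumes S: "open S" and eq: "\<And>x. x \<in> S \<Longrightarrow> f x = g x" and f: "Ck_on k S f"
  shows "Ck_on k S g"
  using eq f
proof (induction k arbitrary: f g)
  case 0
  then show ?case by (simp cong: continuous_on_cong)
next
  case (Suc k)
  have g: "(g has_derivative frechet_derivative f (at x)) (at x)" if "x \<in> S" for x
  proof (rule has_derivative_transform_within_open[OF _ S that])
    show "(f has_derivative frechet_derivative f (at x)) (at x)"
      using Suc.prems(2) that by (simp add: frechet_derivative_works)
  qed (rule Suc.prems(1))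
  then have D: "frechet_derivative f (at x) = frechet_derivative g (at x)" if "x \<in> S" for x
    using frechet_derivative_at that by blast
  have "Ck_on k S (\<lambda>x. frechet_derivative g (at x) v)" for v
    by (rule Suc.IH[of "\<lambda>x. frechet_derivative f (at x) v"]) (use Suc.prems(2) D in auto)
  then show ?case using g by (auto simp: differentiable_def)
qed

text \<open>Lets an explicit derivative \<open>f'\<close> replace \<open>frechet_derivative\<close>,
  so that the closure lemmas below follow from the usual differentiation rules by induction on the
  order.\<close>

lemma Ck_on_SucI:
  assumes S: "open S" and f: "\<And>x. x \<in> S \<Longrightarrow> (f has_derivative f' x) (at x)"
    and f': "\<And>v. Ck_on k S (\<lambda>x. f' x v)"
  shows "Ck_on (Suc k) S f"
proof -
  have D: "f' x = frechet_derivative f (at x)" if "x \<in> S" for x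
    using frechet_derivative_at f that by blast
  have "Ck_on k S (\<lambda>x. frechet_derivative f (at x) v)" for v
    by (rule Ck_on_cong[OF S _ f'[of v]]) (simp add: D)
  then show ?thesis using f by (auto simp: differentiable_def)
qed

text \<open>Serves the product rule, where a factor of order \<open>Suc k\<close> also occurs
  undifferentiated and is needed at order \<open>k\<close>.\<close>

lemma Ck_on_SucD: "Ck_on (Suc k) S f \<Longrightarrow> Ck_on k S f"
proof (induction k arbitrary: f)
  case 0
  then show ?case
    by (auto intro!: continuous_at_imp_continuous_on differentiable_imp_continuous_within)
next
  case (Suc k)
  then show ?case by simp
qed

lemma Ck_on_has_derivative:
  "Ck_on (Suc k) S f \<Longrightarrow> x \<in> S \<Longrightarrow> (f has_derivative frechet_derivative f (at x)) (at x)"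
  by (simp add: frechet_derivative_works)

lemma Ck_on_const:
  assumes "open S"
  shows "Ck_on k S (\<lambda>x. c)"
proof (induction k arbitrary: c)
  case (Suc k)
  show ?case
    by (rule Ck_on_SucI[OF assms has_derivative_const]) (rule Suc)
qed simp

lemma Ck_on_bounded_linear:
  assumes "open S" "bounded_linear f"
  shows "Ck_on k S f"
proof (cases k)
  case 0
  then show ?thesis by (simp add: linear_continuous_on assms)
next
  case (Suc m)
  show ?thesis
    unfolding Suc
    by (rule Ck_on_SucI[OF assms(1) bounded_linear_imp_has_derivative[OF assms(2)]])
      (rule Ck_on_const[OF assms(1)])
qed

lemma Ck_on_add:
  "\<lbrakk>open S; Ck_on k S f; Ck_on k S g\<rbrakk> \<Longrightarrow> Ck_on k S (\<lambda>x. f x + g x)"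
proof (induction k arbitrary: f g)
  case 0
  then show ?case by (simp add: continuous_on_add)
next
  case (Suc k)
  show ?case
    by (rule Ck_on_SucI[OF Suc.prems(1) has_derivative_add[OF Ck_on_has_derivative[OF Suc.prems(2)]
          Ck_on_has_derivative[OF Suc.prems(3)]]])
      (use Suc in auto)
qed

lemma Ck_on_bounded_bilinear:
  assumes B: "bounded_bilinear B"
  shows "\<lbrakk>open S; Ck_on k S f; Ck_on k S g\<rbrakk> \<Longrightarrow> Ck_on k S (\<lambda>x. B (f x) (g x))"
proof (induction k arbitrary: f g)
  case 0
  then show ?case by (simp add: bounded_bilinear.continuous_on[OF B])
next
  case (Suc k)
  show ?case
    by (rule Ck_on_SucI[OF Suc.prems(1) bounded_bilinear.FDERIV[OF B
          Ck_on_has_derivative[OF Suc.prems(2)] Ck_on_has_derivative[OF Suc.prems(3)]]])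
      (use Suc Ck_on_SucD[OF Suc.prems(2)] Ck_on_SucD[OF Suc.prems(3)] in \<open>auto intro!: Ck_on_add\<close>)
qed

lemma Ck_on_Pair:
  "\<lbrakk>open S; Ck_on k S f; Ck_on k S g\<rbrakk> \<Longrightarrow> Ck_on k S (\<lambda>x. (f x, g x))"
proof (induction k arbitrary: f g)
  case 0
  then show ?case by (simp add: continuous_on_Pair)
next
  case (Suc k)
  show ?case
    by (rule Ck_on_SucI[OF Suc.prems(1) has_derivative_Pair[OF Ck_on_has_derivative[OF Suc.prems(2)]
          Ck_on_has_derivative[OF Suc.prems(3)]]])
      (use Suc in auto)
qed

text \<open>The derivative of 1/|Lx| in direction v is -(Lx . Lv)/|Lx|^3, a product of a linear
  function and powers of the same function. The induction therefore closes under products, without a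
  chain rule for \<open>Ck_on\<close>.\<close>

lemma Ck_on_inverse_norm:
  fixes L :: "'a::euclidean_space \<Rightarrow> 'b::euclidean_space"
  assumes S: "open S" and L: "bounded_linear L" and nz: "\<And>x. x \<in> S \<Longrightarrow> L x \<noteq> 0"
  shows "Ck_on k S (\<lambda>x. inverse (norm (L x)))"
proof (induction k)
  case 0
  then show ?case
    using nz by (auto intro!: continuous_on_inverse continuous_on_norm linear_continuous_on[OF L])
next
  case (Suc k)
  have der: "((\<lambda>x. inverse (norm (L x))) has_derivative
      (\<lambda>v. - ((L x \<bullet> L v) * (inverse (norm (L x)) * (inverse (norm (L x)) * inverse (norm (L x))))))) (at x)"
    if "x \<in> S" for x
  proof -
    have "((\<lambda>x. norm (L x)) has_derivative (\<lambda>v. L v \<bullet> sgn (L x))) (at x)"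
      by (rule has_derivative_compose[OF bounded_linear_imp_has_derivative[OF L], of norm])
        (rule has_derivative_norm[OF nz[OF that]])
    from Deriv.has_derivative_inverse[OF _ this]
    have "((\<lambda>x. inverse (norm (L x))) has_derivative
        (\<lambda>v. - (inverse (norm (L x)) * (L v \<bullet> sgn (L x)) * inverse (norm (L x))))) (at x)"
      using nz[OF that] by simp
    then show ?thesis
      by (simp add: sgn_div_norm inner_commute mult_ac)
  qed
  have L_inner: "bounded_linear (\<lambda>x. - (L x \<bullet> c))" for c
    by (intro bounded_linear_minus bounded_linear_compose[OF bounded_linear_inner_left L])
  note mult = Ck_on_bounded_bilinear[OF bounded_bilinear_mult S]
  show ?case
  proof (rule Ck_on_SucI[OF S der])
    fix v
    have "Ck_on k S (\<lambda>x. (- (L x \<bullet> L v)) * (inverse (norm (L x)) * (inverse (norm (L x)) * inverse (norm (L x)))))"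
      by (rule mult[OF Ck_on_bounded_linear[OF S L_inner] mult[OF Suc mult[OF Suc Suc]]])
    then show "Ck_on k S (\<lambda>x. - ((L x \<bullet> L v) * (inverse (norm (L x)) * (inverse (norm (L x)) * inverse (norm (L x))))))"
      by simp
  qed
qed

lemma smooth_map_on_frechet_derivative:
  "smooth_map_on S f \<Longrightarrow> smooth_map_on S (\<lambda>x. frechet_derivative f (at x) v)"
  unfolding smooth_map_on_def by (metis Ck_on.simps(2))

lemma smooth_map_on_has_derivative:
  "smooth_map_on S f \<Longrightarrow> x \<in> S \<Longrightarrow> (f has_derivative frechet_derivative f (at x)) (at x)"
  unfolding smooth_map_on_def by (metis Ck_on_has_derivative)

section \<open>Ricci curvature from an adapted ambient connection\<close>

lemma has_derivative_partial_deriv: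
  "(f has_derivative f') (at u) \<Longrightarrow> partial_deriv i f u = f' (axis i 1)"
  unfolding partial_deriv_def by (metis frechet_derivative_at)

lemma has_derivative_partial_deriv_cong:
  assumes "open U" "u \<in> U" "\<And>x. x \<in> U \<Longrightarrow> f x = h x" "(h has_derivative h') (at u)"
  shows "partial_deriv i f u = h' (axis i 1)"
  by (rule has_derivative_partial_deriv, rule has_derivative_transform_within_open[OF assms(4,1,2)])
    (simp add: assms(3))

text \<open>The determinant is a polynomial in the entries. Through Cramer's rule this yields
  differentiability of the Christoffel symbols.\<close>

lemma differentiable_det:
  fixes M :: "'a::real_normed_vector \<Rightarrow> real ^ 'n ^ 'n"
  assumes "\<And>i j. (\<lambda>x. M x $ i $ j) differentiable (at u)"
  shows "(\<lambda>x. det (M x)) differentiable (at u)"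
proof -
  have "((\<lambda>x. M x $ i $ j) has_derivative frechet_derivative (\<lambda>x. M x $ i $ j) (at u)) (at u)" for i j
    using assms by (simp add: frechet_derivative_works)
  note d = has_derivative_prod[OF this]
  have "(\<lambda>x. \<Prod>i\<in>UNIV. M x $ i $ p i) differentiable (at u)" for p :: "'n \<Rightarrow> 'n"
    unfolding differentiable_def by (rule exI) (rule d)
  then show ?thesis
    unfolding det_def
    by (auto intro!: differentiable_sum differentiable_mult)
qed

lemma
  fixes M :: "real ^ 'n ^ 'n"
  assumes "invertible M"
  shows matrix_mul_matrix_inv: "M ** matrix_inv M = mat 1"
    and matrix_inv_mul_matrix: "matrix_inv M ** M = mat 1"
  using someI_ex[OF assms[unfolded invertible_def]] by (simp_all add: matrix_inv_def)

text \<open>\<open>A\<close> is the difference of a connection and the flat connection of the ambient space,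
  \<open>A' p W\<close> its derivative at \<open>p\<close> in the direction \<open>W\<close>.\<close>

definition connection_curvature ::
    "('e \<Rightarrow> 'e \<Rightarrow> 'e \<Rightarrow> 'e) \<Rightarrow> ('e \<Rightarrow> 'e \<Rightarrow> 'e \<Rightarrow> 'e \<Rightarrow> 'e)
      \<Rightarrow> 'e \<Rightarrow> 'e \<Rightarrow> 'e \<Rightarrow> 'e \<Rightarrow> 'e::euclidean_space" where
  "connection_curvature A A' p X Y Z = A' p X Y Z - A' p Y X Z + A p X (A p Y Z) - A p Y (A p X Z)"

text \<open>\<open>P p\<close> projects the ambient space onto the tangent space at
  \<open>p\<close>, so \<open>range (P (\<phi> u))\<close> stands for that space. \<open>A\<close>
  is torsion-free by \<open>A_commute\<close> and metric by \<open>g_parallel\<close>; the last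
  assumption keeps covariant derivatives of the frame tangent. The product rules are stated for
  arbitrary fields \<open>F\<close> and \<open>H\<close> along the chart because they are applied to
  the frame and to its covariant derivatives.\<close>

locale adapted_chart =
  fixes U :: "(real ^ 'n::finite) set" and \<phi> :: "real ^ 'n \<Rightarrow> 'e::euclidean_space"
    and g :: "'e \<Rightarrow> 'e \<Rightarrow> 'e \<Rightarrow> real" and P :: "'e \<Rightarrow> 'e \<Rightarrow> 'e"
    and A :: "'e \<Rightarrow> 'e \<Rightarrow> 'e \<Rightarrow> 'e" and A' :: "'e \<Rightarrow> 'e \<Rightarrow> 'e \<Rightarrow> 'e \<Rightarrow> 'e"
  assumes open_U: "open U"
    and smooth: "smooth_map_on U \<phi>"
    and inj_derivative: "u \<in> U \<Longrightarrow> inj (frechet_derivative \<phi> (at u))"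
    and linear_P: "u \<in> U \<Longrightarrow> linear (P (\<phi> u))"
    and P_idem: "u \<in> U \<Longrightarrow> P (\<phi> u) (P (\<phi> u) X) = P (\<phi> u) X"
    and dim_range_P: "u \<in> U \<Longrightarrow> dim (range (P (\<phi> u))) = CARD('n)"
    and bilinear_g: "u \<in> U \<Longrightarrow> bounded_bilinear (g (\<phi> u))"
    and g_commute: "u \<in> U \<Longrightarrow> g (\<phi> u) X Y = g (\<phi> u) Y X"
    and g_nondegenerate: "\<lbrakk>u \<in> U; X \<in> range (P (\<phi> u)); \<And>Y. Y \<in> range (P (\<phi> u)) \<Longrightarrow> g (\<phi> u) X Y = 0\<rbrakk>
      \<Longrightarrow> X = 0"
    and bilinear_A: "u \<in> U \<Longrightarrow> bounded_bilinear (A (\<phi> u))"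
    and A_commute: "u \<in> U \<Longrightarrow> A (\<phi> u) X Y = A (\<phi> u) Y X"
    and g_parallel: "\<lbrakk>u \<in> U; (F has_derivative F') (at u); (H has_derivative H') (at u);
       F u \<in> range (P (\<phi> u)); H u \<in> range (P (\<phi> u))\<rbrakk> \<Longrightarrow>
      ((\<lambda>x. g (\<phi> x) (F x) (H x)) has_derivative (\<lambda>h.
         g (\<phi> u) (F' h + A (\<phi> u) (frechet_derivative \<phi> (at u) h) (F u)) (H u)
         + g (\<phi> u) (F u) (H' h + A (\<phi> u) (frechet_derivative \<phi> (at u) h) (H u)))) (at u)"
    and A_derivative: "\<lbrakk>u \<in> U; (F has_derivative F') (at u); (H has_derivative H') (at u)\<rbrakk> \<Longrightarrow>
      ((\<lambda>x. A (\<phi> x) (F x) (H x)) has_derivative (\<lambda>h.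
         A' (\<phi> u) (frechet_derivative \<phi> (at u) h) (F u) (H u)
         + A (\<phi> u) (F' h) (H u) + A (\<phi> u) (F u) (H' h))) (at u)"
    and linear_A'_1: "u \<in> U \<Longrightarrow> linear (\<lambda>X. A' (\<phi> u) X Y Z)"
    and linear_A'_2: "u \<in> U \<Longrightarrow> linear (\<lambda>X. A' (\<phi> u) Y X Z)"
    and tangent: "u \<in> U \<Longrightarrow> frechet_derivative \<phi> (at u) h \<in> range (P (\<phi> u))"
    and second_derivative_tangent: "u \<in> U \<Longrightarrow>
      frechet_derivative (\<lambda>x. frechet_derivative \<phi> (at x) h) (at u) k
      + A (\<phi> u) (frechet_derivative \<phi> (at u) k) (frechet_derivative \<phi> (at u) h) \<in> range (P (\<phi> u))"
begin

section \<open>The coordinate frame and its covariant derivatives\<close>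

definition e :: "'n \<Rightarrow> real ^ 'n \<Rightarrow> 'e" where
  "e i = partial_deriv i \<phi>"

definition e2 :: "'n \<Rightarrow> 'n \<Rightarrow> real ^ 'n \<Rightarrow> 'e" where
  "e2 i j = partial_deriv i (e j)"

text \<open>The covariant derivative of the frame field \<open>e j\<close> in the direction
  \<open>e i\<close>; its coefficients in the frame turn out to be the Christoffel symbols.\<close>

definition De :: "'n \<Rightarrow> 'n \<Rightarrow> real ^ 'n \<Rightarrow> 'e" where
  "De i j u = e2 i j u + A (\<phi> u) (e i u) (e j u)"

abbreviation Rm :: "'e \<Rightarrow> 'e \<Rightarrow> 'e \<Rightarrow> 'e \<Rightarrow> 'e" where
  "Rm \<equiv> connection_curvature A A'"

abbreviation G :: "real ^ 'n \<Rightarrow> real ^ 'n ^ 'n" where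
  "G \<equiv> coord_metric \<phi> g"

lemma G_eq: "G u $ i $ j = g (\<phi> u) (e i u) (e j u)"
  by (simp add: coord_metric_def e_def)

lemma smooth_e: "smooth_map_on U (e i)"
  using smooth_map_on_frechet_derivative[OF smooth, of "axis i 1"]
  by (simp add: e_def partial_deriv_def[abs_def])

lemma smooth_e2: "smooth_map_on U (e2 i j)"
  using smooth_map_on_frechet_derivative[OF smooth_e, of j "axis i 1"]
  by (simp add: e2_def partial_deriv_def[abs_def])

lemma derivative_\<phi>: "frechet_derivative \<phi> (at u) (axis i 1) = e i u"
  by (simp add: e_def partial_deriv_def)

lemma derivative_e: "frechet_derivative (e j) (at u) (axis i 1) = e2 i j u"
  by (simp add: e2_def partial_deriv_def)

lemma has_derivative_\<phi>: "u \<in> U \<Longrightarrow> (\<phi> has_derivative frechet_derivative \<phi> (at u)) (at u)"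
  and has_derivative_e: "u \<in> U \<Longrightarrow> (e i has_derivative frechet_derivative (e i) (at u)) (at u)"
  and has_derivative_e2: "u \<in> U \<Longrightarrow> (e2 i j has_derivative frechet_derivative (e2 i j) (at u)) (at u)"
  using smooth smooth_e smooth_e2 smooth_map_on_has_derivative by blast+

lemma e2_commute: "u \<in> U \<Longrightarrow> e2 i j u = e2 j i u"
  using Ck_on_2_symmetric[OF open_U, of u \<phi> "axis j 1" "axis i 1"] smooth
  by (simp add: e2_def e_def partial_deriv_def[abs_def] smooth_map_on_def)

lemma partial_deriv_e2_commute:
  "u \<in> U \<Longrightarrow> partial_deriv i (e2 j k) u = partial_deriv j (e2 i k) u"
  using Ck_on_2_symmetric[OF open_U, of u "e k" "axis j 1" "axis i 1"] smooth_e[of k]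
  by (simp add: e2_def partial_deriv_def[abs_def] smooth_map_on_def)

lemma De_commute: "u \<in> U \<Longrightarrow> De i j u = De j i u"
  by (simp add: De_def e2_commute[of u i j] A_commute[of u "e i u"])

lemma linear_derivative: "u \<in> U \<Longrightarrow> linear (frechet_derivative \<phi> (at u))"
  using has_derivative_\<phi> has_derivative_linear by blast

lemma derivative_expansion:
  assumes "u \<in> U"
  shows "frechet_derivative \<phi> (at u) x = (\<Sum>k\<in>UNIV. x $ k *\<^sub>R e k u)"
proof -
  have "frechet_derivative \<phi> (at u) x = frechet_derivative \<phi> (at u) (\<Sum>k\<in>UNIV. x $ k *\<^sub>R axis k 1)"
    using basis_expansion[of x] by (simp add: scalar_mult_eq_scaleR)
  also have "\<dots> = (\<Sum>k\<in>UNIV. x $ k *\<^sub>R e k u)"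
    by (simp add: linear_sum[OF linear_derivative[OF assms]]
        linear_scale[OF linear_derivative[OF assms]] derivative_\<phi>)
  finally show ?thesis .
qed

lemma frame_independent:
  assumes "u \<in> U" "(\<Sum>k\<in>UNIV. a k *\<^sub>R e k u) = (\<Sum>k\<in>UNIV. b k *\<^sub>R e k u)"
  shows "a k = b k"
proof -
  have "frechet_derivative \<phi> (at u) (\<chi> k. a k) = frechet_derivative \<phi> (at u) (\<chi> k. b k)"
    using assms by (simp add: derivative_expansion)
  then have "(\<chi> k. a k) = (\<chi> k. b k)"
    using inj_derivative[OF assms(1)] by (simp add: inj_eq)
  then show ?thesis by (simp add: vec_eq_iff)
qed

text \<open>The image of the injective derivative lies in the tangent space and has the same
  dimension.\<close>

lemma frame_spans:
  assumes u: "u \<in> U" and X: "X \<in> range (P (\<phi> u))"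
  obtains x where "X = (\<Sum>k\<in>UNIV. x $ k *\<^sub>R e k u)"
proof -
  let ?D = "frechet_derivative \<phi> (at u)"
  have "dim (range ?D) = CARD('n)"
    using dim_image_eq[of ?D UNIV] linear_derivative[OF u] inj_derivative[OF u] by simp
  moreover have "subspace (range ?D)" "subspace (range (P (\<phi> u)))"
    using linear_subspace_image[OF linear_derivative[OF u], of UNIV]
      linear_subspace_image[OF linear_P[OF u], of UNIV] by simp_all
  moreover have "range ?D \<subseteq> range (P (\<phi> u))"
    using tangent[OF u] by auto
  ultimately have "range ?D = range (P (\<phi> u))"
    using dim_range_P[OF u] by (intro subspace_dim_equal) auto
  then obtain x where "X = ?D x"
    using X by blast
  then show thesis
    using that derivative_expansion[OF u] by simp
qed

lemma e_tangent: "u \<in> U \<Longrightarrow> e i u \<in> range (P (\<phi> u))"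
  using tangent[of u "axis i 1"] by (simp add: derivative_\<phi>)

lemma De_tangent: "u \<in> U \<Longrightarrow> De i j u \<in> range (P (\<phi> u))"
  using second_derivative_tangent[of u "axis j 1" "axis i 1"]
  by (simp add: De_def e2_def e_def partial_deriv_def[abs_def])

lemma g_sum_left:
  "u \<in> U \<Longrightarrow> g (\<phi> u) (\<Sum>k\<in>UNIV. x $ k *\<^sub>R e k u) Y = (\<Sum>k\<in>UNIV. x $ k * g (\<phi> u) (e k u) Y)"
  by (simp add: bounded_bilinear.sum_left[OF bilinear_g] bounded_bilinear.scaleR_left[OF bilinear_g])

lemma G_mult:
  assumes "u \<in> U"
  shows "G u *v x = (\<chi> l. g (\<phi> u) (\<Sum>k\<in>UNIV. x $ k *\<^sub>R e k u) (e l u))"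
  by (simp add: vec_eq_iff matrix_vector_mult_def G_eq g_commute[OF assms, of "sum _ _"]
      bounded_bilinear.sum_right[OF bilinear_g[OF assms]]
      bounded_bilinear.scaleR_right[OF bilinear_g[OF assms]] mult.commute)

text \<open>A kernel vector of \<open>G u\<close> gives a tangent vector orthogonal to the frame,
  hence to every tangent vector. Nondegeneracy makes it zero, and independence of the frame makes
  its coefficients zero. The argument does not rely on definiteness, so it covers Lorentzian
  metrics.\<close>

lemma G_invertible:
  assumes u: "u \<in> U"
  shows "invertible (G u)"
proof -
  have "x = 0" if "G u *v x = 0" for x
  proof -
    let ?X = "\<Sum>k\<in>UNIV. x $ k *\<^sub>R e k u"
    have X: "?X \<in> range (P (\<phi> u))"
      using tangent[OF u, of x] by (simp add: derivative_expansion[OF u])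
    have *: "g (\<phi> u) (e l u) ?X = 0" for l
      using that by (simp add: G_mult[OF u] vec_eq_iff g_commute[OF u, of "e l u"])
    have "?X = 0"
    proof (rule g_nondegenerate[OF u X])
      fix Y assume "Y \<in> range (P (\<phi> u))"
      then obtain y where "Y = (\<Sum>k\<in>UNIV. y $ k *\<^sub>R e k u)"
        using frame_spans[OF u] by blast
      then have "g (\<phi> u) Y ?X = 0"
        by (simp add: g_sum_left[OF u] *)
      then show "g (\<phi> u) ?X Y = 0"
        using g_commute[OF u] by simp
    qed
    then have "x $ k = 0" for k
      using frame_independent[OF u, of "\<lambda>k. x $ k" "\<lambda>_. 0"] by simp
    then show ?thesis by (simp add: vec_eq_iff)
  qed
  then show ?thesis
    by (simp add: invertible_left_inverse matrix_left_invertible_ker)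
qed

section \<open>Christoffel symbols by Koszul's formula\<close>

lemma partial_deriv_G:
  assumes u: "u \<in> U"
  shows "partial_deriv i (\<lambda>x. G x $ j $ l) u = g (\<phi> u) (De i j u) (e l u) + g (\<phi> u) (e j u) (De i l u)"
  unfolding G_eq
  using has_derivative_partial_deriv[OF g_parallel[OF u has_derivative_e[OF u] has_derivative_e[OF u] e_tangent[OF u] e_tangent[OF u]]]
  by (simp add: derivative_\<phi> derivative_e De_def)

text \<open>Metric compatibility turns the left side into six products; symmetry of
  \<open>De\<close> in its indices cancels four of them and identifies the other two.\<close>

lemma koszul_formula:
  assumes u: "u \<in> U"
  shows "partial_deriv i (\<lambda>x. G x $ j $ l) u + partial_deriv j (\<lambda>x. G x $ i $ l) u
      - partial_deriv l (\<lambda>x. G x $ i $ j) u = 2 * g (\<phi> u) (De i j u) (e l u)"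
  using De_commute[OF u, of j i] De_commute[OF u, of l i] De_commute[OF u, of l j]
    g_commute[OF u, of "e j u" "De i l u"] g_commute[OF u, of "e i u" "De j l u"]
  by (simp add: partial_deriv_G[OF u])

lemma christoffel_eq:
  assumes u: "u \<in> U"
  shows "(\<chi> k. christoffel G k i j u) = matrix_inv (G u) *v (\<chi> l. g (\<phi> u) (De i j u) (e l u))"
  unfolding christoffel_def koszul_formula[OF u]
  by (simp add: vec_eq_iff matrix_vector_mult_def sum_distrib_left)

lemma G_mult_christoffel:
  assumes u: "u \<in> U"
  shows "G u *v (\<chi> k. christoffel G k i j u) = (\<chi> l. g (\<phi> u) (De i j u) (e l u))"
  unfolding christoffel_eq[OF u]
  by (simp add: matrix_vector_mul_assoc matrix_mul_matrix_inv[OF G_invertible[OF u]])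

text \<open>Since \<open>De i j u\<close> is tangent it has frame coefficients \<open>x\<close>.
  Koszul's formula presents the Christoffel symbols as \<open>matrix_inv (G u)\<close> applied to
  \<open>G u *v x\<close>, which is \<open>x\<close>.\<close>

lemma sum_christoffel:
  assumes u: "u \<in> U"
  shows "(\<Sum>k\<in>UNIV. christoffel G k i j u *\<^sub>R e k u) = De i j u"
proof -
  obtain x where x: "De i j u = (\<Sum>k\<in>UNIV. x $ k *\<^sub>R e k u)"
    using frame_spans[OF u De_tangent[OF u]] by blast
  have "(\<chi> k. christoffel G k i j u) = matrix_inv (G u) *v (G u *v x)"
    unfolding christoffel_eq[OF u] G_mult[OF u] x ..
  also have "\<dots> = x"
    by (simp add: matrix_vector_mul_assoc matrix_inv_mul_matrix[OF G_invertible[OF u]])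
  finally show ?thesis
    unfolding x by (simp add: vec_eq_iff)
qed

section \<open>Differentiating the Christoffel symbols; Riemann and Ricci tensors\<close>

lemma has_derivative_De:
  assumes u: "u \<in> U"
  shows "(De i j has_derivative (\<lambda>h. frechet_derivative (e2 i j) (at u) h
      + (A' (\<phi> u) (frechet_derivative \<phi> (at u) h) (e i u) (e j u)
         + A (\<phi> u) (frechet_derivative (e i) (at u) h) (e j u)
         + A (\<phi> u) (e i u) (frechet_derivative (e j) (at u) h)))) (at u)"
  unfolding De_def[abs_def]
  by (rule has_derivative_add[OF has_derivative_e2[OF u]
        A_derivative[OF u has_derivative_e[OF u] has_derivative_e[OF u]]])

text \<open>Cramer's rule writes each symbol as a quotient of determinants with differentiable
  entries, which avoids differentiating the inverse matrix. Only with this do the partial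
  derivatives in \<open>riemann\<close> obey the product rule.\<close>

lemma christoffel_differentiable:
  assumes u: "u \<in> U"
  shows "christoffel G k i j differentiable (at u)"
proof -
  let ?b = "\<lambda>u. \<chi> l. g (\<phi> u) (De i j u) (e l u)"
  \<comment> \<open>The matrix \<open>G\<close> with its \<open>k\<close>-th column replaced by
    \<open>?b\<close>, as in Cramer's rule.\<close>
  let ?N = "\<lambda>u. \<chi> p q. if q = k then ?b u $ p else G u $ p $ q"
  have G: "(\<lambda>x. G x $ p $ q) differentiable (at u)" for p q
    unfolding G_eq differentiable_def
    using g_parallel[OF u has_derivative_e[OF u] has_derivative_e[OF u] e_tangent[OF u] e_tangent[OF u]] by blast
  have b: "(\<lambda>x. ?b x $ l) differentiable (at u)" for l
    unfolding differentiable_def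
    using g_parallel[OF u has_derivative_De[OF u] has_derivative_e[OF u] De_tangent[OF u] e_tangent[OF u]] by auto
  have N: "(\<lambda>x. ?N x $ p $ q) differentiable (at u)" for p q
    using b[of p] G[of p q] by (cases "q = k") auto
  have det: "det (G x) \<noteq> 0" if "x \<in> U" for x
    using G_invertible[OF that] by (simp add: invertible_det_nz)
  have eq: "det (?N x) / det (G x) = christoffel G k i j x" if "x \<in> U" for x
    using cramer[OF det[OF that], of "\<chi> k. christoffel G k i j x" "?b x"]
      G_mult_christoffel[OF that, of i j] by (simp add: vec_eq_iff)
  have "(\<lambda>x. det (?N x) / det (G x)) differentiable (at u)"
    using det[OF u] by (intro differentiable_divide differentiable_det N G)
  then show ?thesis
    using has_derivative_transform_within_open[OF _ open_U u, of _ _ UNIV] eq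
    unfolding differentiable_def by blast
qed

text \<open>Differentiate \<open>De j l\<close> in direction \<open>i\<close>, once through its
  frame expansion by Christoffel symbols and once through its definition by \<open>A\<close>,
  compare, and antisymmetrize in \<open>i\<close> and \<open>j\<close>.\<close>

lemma sum_riemann:
  assumes u: "u \<in> U"
  shows "(\<Sum>k\<in>UNIV. riemann G k l i j u *\<^sub>R e k u) = Rm (\<phi> u) (e i u) (e j u) (e l u)"
proof -
  interpret A: bounded_bilinear "A (\<phi> u)" by (rule bilinear_A[OF u])
  have ch: "(christoffel G k i j has_derivative frechet_derivative (christoffel G k i j) (at u)) (at u)" for k i j
    using christoffel_differentiable[OF u] by (simp add: frechet_derivative_works)
  \<comment> \<open>\<open>?L i j\<close> is the half of the Riemann tensor that remains before
    subtracting the same terms with \<open>i\<close> and \<open>j\<close> exchanged.\<close>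
  have "(\<Sum>k\<in>UNIV. partial_deriv i (christoffel G k j l) u *\<^sub>R e k u)
      + (\<Sum>k\<in>UNIV. (\<Sum>m\<in>UNIV. christoffel G k i m u * christoffel G m j l u) *\<^sub>R e k u)
      = partial_deriv i (e2 j l) u + A' (\<phi> u) (e i u) (e j u) (e l u)
        + A (\<phi> u) (e2 i j u) (e l u) + A (\<phi> u) (e j u) (e2 i l u)
        + A (\<phi> u) (e i u) (e2 j l u) + A (\<phi> u) (e i u) (A (\<phi> u) (e j u) (e l u))" (is "?L i j = ?R i j") for i j
  proof -
    have 1: "partial_deriv i (De j l) u
      = (\<Sum>k\<in>UNIV. christoffel G k j l u *\<^sub>R e2 i k u + partial_deriv i (christoffel G k j l) u *\<^sub>R e k u)"
    proof (rule trans[OF has_derivative_partial_deriv_cong[OF open_U u]])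
      show "De j l x = (\<Sum>k\<in>UNIV. christoffel G k j l x *\<^sub>R e k x)" if "x \<in> U" for x
        using sum_christoffel[OF that] by simp
      show "((\<lambda>x. \<Sum>k\<in>UNIV. christoffel G k j l x *\<^sub>R e k x) has_derivative
         (\<lambda>h. \<Sum>k\<in>UNIV. christoffel G k j l u *\<^sub>R frechet_derivative (e k) (at u) h
            + frechet_derivative (christoffel G k j l) (at u) h *\<^sub>R e k u)) (at u)"
        by (intro has_derivative_sum has_derivative_scaleR ch has_derivative_e[OF u])
    qed (simp add: derivative_e partial_deriv_def)
    \<comment> \<open>Expressing the differentiated frame vectors in the frame again produces the
      terms quadratic in the Christoffel symbols.\<close>
    have 2: "e2 i k u = (\<Sum>m\<in>UNIV. christoffel G m i k u *\<^sub>R e m u) - A (\<phi> u) (e i u) (e k u)" for k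
      by (simp add: sum_christoffel[OF u] De_def)
    have 3: "(\<Sum>k\<in>UNIV. christoffel G k j l u *\<^sub>R A (\<phi> u) (e i u) (e k u)) = A (\<phi> u) (e i u) (De j l u)"
      by (simp add: sum_christoffel[OF u, symmetric] A.sum_right A.scaleR_right)
    have 4: "(\<Sum>k\<in>UNIV. christoffel G k j l u *\<^sub>R (\<Sum>m\<in>UNIV. christoffel G m i k u *\<^sub>R e m u))
      = (\<Sum>k\<in>UNIV. (\<Sum>m\<in>UNIV. christoffel G k i m u * christoffel G m j l u) *\<^sub>R e k u)"
      unfolding scaleR_sum_right scaleR_sum_left scaleR_scaleR
      by (subst sum.swap) (simp add: mult.commute)
    have "?L i j = partial_deriv i (De j l) u + A (\<phi> u) (e i u) (De j l u)"
      unfolding 1 2 sum.distrib scaleR_diff_right sum_subtractf 3 4 by simp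
    also have "partial_deriv i (De j l) u = partial_deriv i (e2 j l) u + A' (\<phi> u) (e i u) (e j u) (e l u)
        + A (\<phi> u) (e2 i j u) (e l u) + A (\<phi> u) (e j u) (e2 i l u)"
      using has_derivative_partial_deriv[OF has_derivative_De[OF u]]
      by (simp add: derivative_e derivative_\<phi> partial_deriv_def)
    finally show ?thesis
      by (simp add: De_def A.add_right)
  qed
  note L = this
  have "(\<Sum>k\<in>UNIV. riemann G k l i j u *\<^sub>R e k u) = ?L i j - ?L j i"
    unfolding riemann_def
    by (simp add: sum_subtractf sum.distrib scaleR_add_left scaleR_diff_left)
  \<comment> \<open>The third derivatives of \<open>\<phi>\<close>, the term with
    \<open>e2 i j\<close>, and the sum of the two mixed terms with \<open>e2 i l\<close> and
    \<open>e2 j l\<close> are symmetric in \<open>i\<close> and \<open>j\<close> and cancel.\<close>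
  also have "\<dots> = Rm (\<phi> u) (e i u) (e j u) (e l u)"
    unfolding L connection_curvature_def
    by (simp add: partial_deriv_e2_commute[OF u, of i j] e2_commute[OF u, of i j])
  finally show ?thesis .
qed

lemma linear_Rm: "u \<in> U \<Longrightarrow> linear (\<lambda>X. Rm (\<phi> u) X Y Z)"
  unfolding connection_curvature_def
  by (intro linear_compose_add linear_compose_sub linear_A'_1 linear_A'_2
      bounded_linear.linear[OF bounded_bilinear.bounded_linear_left[OF bilinear_A]]
      bounded_linear.linear[OF bounded_linear_compose[OF bounded_bilinear.bounded_linear_right[OF bilinear_A]
        bounded_bilinear.bounded_linear_left[OF bilinear_A]]])

text \<open>The trace of an endomorphism \<open>L\<close> of the tangent space equals the trace of \<open>L \<circ> P\<close> on the
  ambient space, which does not involve the coordinate frame.\<close>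

lemma ricci_eq_trace:
  assumes u: "u \<in> U"
  shows "ricci G i j u = (\<Sum>b\<in>Basis. Rm (\<phi> u) (P (\<phi> u) b) (e j u) (e i u) \<bullet> b)"
proof -
  let ?P = "P (\<phi> u)" and ?L = "\<lambda>X. Rm (\<phi> u) X (e j u) (e i u)"
  note L = linear_Rm[OF u, of "e j u" "e i u"]
  have "\<exists>x. ?P b = (\<Sum>k\<in>UNIV. x $ k *\<^sub>R e k u)" for b
    using frame_spans[OF u, of "?P b"] by blast
  then obtain c where c: "\<And>b. ?P b = (\<Sum>k\<in>UNIV. c b $ k *\<^sub>R e k u)"
    by metis
  have P_e: "?P (e k u) = e k u" for k
    using e_tangent[OF u, of k] P_idem[OF u] by auto
  have Le: "?L (e k u) = (\<Sum>m\<in>UNIV. riemann G m i k j u *\<^sub>R e m u)" for k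
    by (simp add: sum_riemann[OF u])
  \<comment> \<open>By linearity of \<open>?P\<close>, the left side is the \<open>m\<close>-th
    frame coefficient of \<open>?P (?L (e k u))\<close>. The vector \<open>?L (e k u)\<close> is
    tangent, hence fixed by \<open>?P\<close>, and its coefficients are components of
    \<open>riemann\<close>.\<close>
  have "(\<Sum>b\<in>Basis. ?L (e k u) \<bullet> b * c b $ m) = riemann G m i k j u" for k m
  proof -
    have "(\<Sum>m\<in>UNIV. (\<Sum>b\<in>Basis. ?L (e k u) \<bullet> b * c b $ m) *\<^sub>R e m u)
        = (\<Sum>b\<in>Basis. (?L (e k u) \<bullet> b) *\<^sub>R ?P b)"
      unfolding c scaleR_sum_left scaleR_sum_right scaleR_scaleR by (rule sum.swap)
    also have "\<dots> = ?P (\<Sum>b\<in>Basis. (?L (e k u) \<bullet> b) *\<^sub>R b)"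
      by (simp add: linear_sum[OF linear_P[OF u]] linear_scale[OF linear_P[OF u]])
    also have "\<dots> = ?P (?L (e k u))"
      by (simp only: euclidean_representation)
    also have "\<dots> = (\<Sum>m\<in>UNIV. riemann G m i k j u *\<^sub>R e m u)"
      unfolding Le by (simp add: linear_sum[OF linear_P[OF u]] linear_scale[OF linear_P[OF u]] P_e)
    finally show ?thesis by (rule frame_independent[OF u])
  qed
  then have "ricci G i j u = (\<Sum>k\<in>UNIV. \<Sum>b\<in>Basis. ?L (e k u) \<bullet> b * c b $ k)"
    by (simp add: ricci_def)
  also have "\<dots> = (\<Sum>b\<in>Basis. \<Sum>k\<in>UNIV. (c b $ k *\<^sub>R ?L (e k u)) \<bullet> b)"
    by (subst sum.swap) (simp add: mult.commute)
  also have "\<dots> = (\<Sum>b\<in>Basis. ?L (?P b) \<bullet> b)"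
    unfolding c linear_sum[OF L] linear_scale[OF L] inner_sum_left ..
  finally show ?thesis .
qed

end

section \<open>Polar parametrization\<close>

text \<open>The index \<open>None\<close> carries time and \<open>Some i\<close> the Cartesian space
  coordinates. Radius and direction of the space part give a single parametrization of the whole
  manifold, so no charts of the sphere are required.\<close>

definition sphere_polar :: "real ^ 'd option \<Rightarrow> real \<times> real \<times> (real ^ 'd::finite)" where
  "sphere_polar x = (x $ None, norm (\<chi> i. x $ Some i), inverse (norm (\<chi> i. x $ Some i)) *\<^sub>R (\<chi> i. x $ Some i))"

definition cartesian :: "real \<times> real \<times> (real ^ 'd::finite) \<Rightarrow> real ^ 'd option" where
  "cartesian = (\<lambda>(t, r, \<omega>). t *\<^sub>R axis None 1 + r *\<^sub>R (\<chi> k. case k of None \<Rightarrow> 0 | Some i \<Rightarrow> \<omega> $ i))"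

lemma bounded_linear_space_part: "bounded_linear (\<lambda>x :: real ^ 'd::finite option. \<chi> i. x $ Some i)"
  unfolding linear_conv_bounded_linear[symmetric] by (rule linearI) (auto simp: vec_eq_iff)

lemma bounded_linear_space_embed:
  "bounded_linear (\<lambda>\<omega> :: real ^ 'd::finite. \<chi> k. case k of None \<Rightarrow> 0 | Some i \<Rightarrow> \<omega> $ i)"
  unfolding linear_conv_bounded_linear[symmetric]
  by (rule linearI) (auto simp: vec_eq_iff split: option.split)

text \<open>\<open>cartesian\<close> is differentiable on the whole ambient space and a left inverse
  of \<open>sphere_polar\<close> on \<open>U\<close>. The chain rule then gives injectivity of the
  derivative, and its restriction to \<open>M\<close> is the continuous inverse.\<close>

lemma local_parametrization_sphere_polar:
  fixes I :: "real set"
  assumes I: "open I" "I \<subseteq> {0<..}"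
  defines "U \<equiv> {x :: real ^ 'd::finite option. norm (\<chi> i. x $ Some i) \<in> I}"
    and "M \<equiv> {(t, r, \<omega> :: real ^ 'd). r \<in> I \<and> \<omega> \<in> sphere 0 1}"
  shows "local_parametrization M U sphere_polar" and "sphere_polar ` U = M"
proof -
  let ?L = "\<lambda>x :: real ^ 'd option. \<chi> i. x $ Some i :: real ^ 'd"
  let ?E = "\<lambda>\<omega> :: real ^ 'd. \<chi> k. case k of None \<Rightarrow> 0 | Some i \<Rightarrow> \<omega> $ i"
  note L = bounded_linear_space_part[where 'd='d]
  note E = bounded_linear_space_embed[where 'd='d]
  have nz: "?L x \<noteq> 0" if "x \<in> U" for x
    using that I(2) by (auto simp: U_def)
  have "continuous_on UNIV (\<lambda>x. norm (?L x))"
    by (intro continuous_on_norm linear_continuous_on L)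
  from open_vimage[OF I(1) this] have U: "open U"
    by (simp add: vimage_def U_def)
  have inverse_norm: "Ck_on k U (\<lambda>x. inverse (norm (?L x)))" for k
    by (rule Ck_on_inverse_norm[OF U L nz])
  have norm: "Ck_on k U (\<lambda>x. norm (?L x))" for k
  proof (rule Ck_on_cong[OF U])
    \<comment> \<open>The norm is rewritten as |Lx|^2/|Lx|, a product of maps already known to be of
      class C^k.\<close>
    show "Ck_on k U (\<lambda>x. (?L x \<bullet> ?L x) * inverse (norm (?L x)))"
      by (intro Ck_on_bounded_bilinear[OF bounded_bilinear_mult U _ inverse_norm]
          Ck_on_bounded_bilinear[OF bounded_bilinear_inner U] Ck_on_bounded_linear[OF U L])
  next
    fix x assume "x \<in> U"
    then show "(?L x \<bullet> ?L x) * inverse (norm (?L x)) = norm (?L x)"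
      using nz by (simp add: dot_square_norm power2_eq_square field_simps)
  qed
  have smooth: "smooth_map_on U sphere_polar"
    unfolding smooth_map_on_def sphere_polar_def[abs_def]
    by (intro allI Ck_on_Pair[OF U Ck_on_bounded_linear[OF U bounded_linear_vec_nth] Ck_on_Pair[OF U norm]]
        Ck_on_bounded_bilinear[OF bounded_bilinear_scaleR U inverse_norm] Ck_on_bounded_linear[OF U L])
  have left: "cartesian (sphere_polar x) = x" if "x \<in> U" for x
    using nz[OF that]
    by (auto simp: cartesian_def sphere_polar_def vec_eq_iff axis_def split: option.split)
  have right: "cartesian p \<in> U" "sphere_polar (cartesian p) = p" if "p \<in> M" for p
  proof -
    obtain t r \<omega> where p: "p = (t, r, \<omega>)" by (metis prod_cases3)
    have *: "(\<chi> i. cartesian p $ Some i) = r *\<^sub>R \<omega>" "cartesian p $ None = t"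
      by (auto simp: p cartesian_def vec_eq_iff axis_def)
    have r: "r \<in> I" "r > 0" "norm \<omega> = 1"
      using that I(2) by (auto simp: p M_def)
    show "cartesian p \<in> U" using r by (simp add: U_def *)
    show "sphere_polar (cartesian p) = p"
      unfolding sphere_polar_def * using r by (simp add: p)
  qed
  have mem: "sphere_polar x \<in> M" if "x \<in> U" for x
    using that nz[OF that] by (auto simp: M_def U_def sphere_polar_def)
  show image: "sphere_polar ` U = M"
    using mem right by force
  have deriv: "\<exists>D. (cartesian has_derivative D) (at p)" for p :: "real \<times> real \<times> (real ^ 'd)"
    unfolding cartesian_def split_beta
    by (rule exI, (rule has_derivative_add has_derivative_scaleR has_derivative_fst has_derivative_snd
        bounded_linear.has_derivative[OF E] has_derivative_const has_derivative_ident)+)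
  have inj: "inj (frechet_derivative sphere_polar (at x))" if "x \<in> U" for x
  proof -
    obtain D where "(cartesian has_derivative D) (at (sphere_polar x))"
      using deriv by blast
    from diff_chain_at[OF smooth_map_on_has_derivative[OF smooth that] this]
    have "(cartesian \<circ> sphere_polar has_derivative D \<circ> frechet_derivative sphere_polar (at x)) (at x)" .
    moreover have "(cartesian \<circ> sphere_polar has_derivative id) (at x)"
      by (rule has_derivative_transform_within_open[OF has_derivative_id U that]) (simp add: left)
    ultimately have "D \<circ> frechet_derivative sphere_polar (at x) = id"
      using has_derivative_unique by blast
    then show ?thesis
      by (metis inj_on_id inj_on_imageI2)
  qed
  have "homeomorphism U M sphere_polar cartesian"
  proof (rule homeomorphismI)
    show "continuous_on U sphere_polar"
      using smooth unfolding smooth_map_on_def by (metis Ck_on.simps(1))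
    show "continuous_on M cartesian"
      using deriv by (meson continuous_at_imp_continuous_on has_derivative_continuous)
  qed (use left right mem in auto)
  then show "local_parametrization M U sphere_polar"
    unfolding local_parametrization_def image using U smooth inj by auto
qed

section \<open>Static spherically symmetric metrics\<close>

lemma trace_prod:
  fixes f :: "'a::euclidean_space \<times> 'b::euclidean_space \<Rightarrow> 'a \<times> 'b"
  shows "(\<Sum>b\<in>Basis. f b \<bullet> b)
    = (\<Sum>a\<in>Basis. fst (f (a, 0)) \<bullet> a) + (\<Sum>b\<in>Basis. snd (f (0, b)) \<bullet> b)"
  unfolding Basis_prod_def
  by (subst sum.union_disjoint)
    (auto simp: sum.reindex inj_on_def Basis_prod_def inner_prod_def)

type_synonym 'b event = "real \<times> real \<times> (real ^ 'b)"

text \<open>\<open>F1\<close> and \<open>F2\<close> are the first two derivatives of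
  \<open>F\<close>, and \<open>dim_type\<close> fixes the type whose cardinality is d.
  \<open>F\<close> may have either sign, so both sides of the horizon are covered.\<close>

locale static_spherical =
  fixes F F1 F2 :: "real \<Rightarrow> real" and I :: "real set" and dim_type :: "'d::finite itself"
  assumes open_I: "open I" and I_pos: "r \<in> I \<Longrightarrow> r > 0" and F_nz: "r \<in> I \<Longrightarrow> F r \<noteq> 0"
    and F_deriv: "r \<in> I \<Longrightarrow> (F has_real_derivative F1 r) (at r)"
    and F1_deriv: "r \<in> I \<Longrightarrow> (F1 has_real_derivative F2 r) (at r)"
begin

section \<open>Metric, tangent projection and connection\<close>

definition M :: "'d event set" where
  "M = {(t, r, \<omega>). r \<in> I \<and> \<omega> \<in> sphere 0 1}"

definition metric :: "'d event \<Rightarrow> 'd event \<Rightarrow> 'd event \<Rightarrow> real" where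
  "metric = (\<lambda>(t, r, \<omega>) (v_t, v_r, v_\<omega>) (w_t, w_r, w_\<omega>).
     - F r * (v_t * w_t) + 1 / F r * (v_r * w_r) + r\<^sup>2 * (v_\<omega> \<bullet> w_\<omega>))"

text \<open>On \<open>M\<close>, where \<open>\<omega>\<close> is a unit vector, this is the
  Euclidean orthogonal projection onto the tangent space.\<close>

definition proj :: "'d event \<Rightarrow> 'd event \<Rightarrow> 'd event" where
  "proj = (\<lambda>(t, r, \<omega>) (v_t, v_r, v_\<omega>). (v_t, v_r, v_\<omega> - (\<omega> \<bullet> v_\<omega>) *\<^sub>R \<omega>))"

text \<open>In the usual notation \<open>\<alpha>\<close> is Gamma^t_tr and -Gamma^r_rr,
  \<open>\<beta>\<close> is Gamma^r_tt, and -\<open>\<gamma>\<close> is the factor of the round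
  metric in the r-component. The suffix 1 marks the derivative in \<open>r\<close>.\<close>

definition \<alpha> :: "real \<Rightarrow> real" where "\<alpha> r = F1 r / (2 * F r)"
definition \<alpha>1 :: "real \<Rightarrow> real" where "\<alpha>1 r = F2 r / (2 * F r) - (F1 r)\<^sup>2 / (2 * (F r)\<^sup>2)"
definition \<beta> :: "real \<Rightarrow> real" where "\<beta> r = F r * F1 r / 2"
definition \<beta>1 :: "real \<Rightarrow> real" where "\<beta>1 r = ((F1 r)\<^sup>2 + F r * F2 r) / 2"
definition \<gamma> :: "real \<Rightarrow> real" where "\<gamma> r = r * F r"
definition \<gamma>1 :: "real \<Rightarrow> real" where "\<gamma>1 r = F r + r * F1 r"

text \<open>The Christoffel symbols of the metric in the variables \<open>t\<close> and \<open>r\<close>; the term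
  \<open>(v_\<omega> \<bullet> w_\<omega>) *\<^sub>R \<omega>\<close> is the second fundamental form of the unit sphere and makes covariant
  derivatives of tangent fields tangent.\<close>

definition conn :: "'d event \<Rightarrow> 'd event \<Rightarrow> 'd event \<Rightarrow> 'd event" where
  "conn = (\<lambda>(t, r, \<omega>) (v_t, v_r, v_\<omega>) (w_t, w_r, w_\<omega>).
     (\<alpha> r * (v_t * w_r + v_r * w_t),
      \<beta> r * (v_t * w_t) - \<alpha> r * (v_r * w_r) - \<gamma> r * (v_\<omega> \<bullet> w_\<omega>),
      inverse r *\<^sub>R (v_r *\<^sub>R w_\<omega> + w_r *\<^sub>R v_\<omega>) + (v_\<omega> \<bullet> w_\<omega>) *\<^sub>R \<omega>))"

text \<open>The derivative of \<open>conn\<close> in its base point in the direction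
  \<open>(u_t, u_r, u_\<omega>)\<close>, with both vector arguments held fixed.\<close>

definition conn1 :: "'d event \<Rightarrow> 'd event \<Rightarrow> 'd event \<Rightarrow> 'd event \<Rightarrow> 'd event" where
  "conn1 = (\<lambda>(t, r, \<omega>) (u_t, u_r, u_\<omega>) (v_t, v_r, v_\<omega>) (w_t, w_r, w_\<omega>).
     (u_r * \<alpha>1 r * (v_t * w_r + v_r * w_t),
      u_r * \<beta>1 r * (v_t * w_t) - u_r * \<alpha>1 r * (v_r * w_r) - u_r * \<gamma>1 r * (v_\<omega> \<bullet> w_\<omega>),
      (- u_r / r\<^sup>2) *\<^sub>R (v_r *\<^sub>R w_\<omega> + w_r *\<^sub>R v_\<omega>) + (v_\<omega> \<bullet> w_\<omega>) *\<^sub>R u_\<omega>))"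

lemma \<alpha>_deriv: "r \<in> I \<Longrightarrow> (\<alpha> has_real_derivative \<alpha>1 r) (at r)"
  unfolding \<alpha>_def[abs_def] \<alpha>1_def using F_nz[of r]
  by (auto intro!: derivative_eq_intros F_deriv F1_deriv simp: field_simps power2_eq_square)

lemma \<beta>_deriv: "r \<in> I \<Longrightarrow> (\<beta> has_real_derivative \<beta>1 r) (at r)"
  unfolding \<beta>_def[abs_def] \<beta>1_def
  by (auto intro!: derivative_eq_intros F_deriv F1_deriv simp: field_simps power2_eq_square)

lemma \<gamma>_deriv: "r \<in> I \<Longrightarrow> (\<gamma> has_real_derivative \<gamma>1 r) (at r)"
  unfolding \<gamma>_def[abs_def] \<gamma>1_def
  by (auto intro!: derivative_eq_intros F_deriv F1_deriv simp: field_simps power2_eq_square)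

lemma inverse_deriv: "r \<in> I \<Longrightarrow> (inverse has_real_derivative - 1 / r\<^sup>2) (at r)"
  using I_pos[of r] by (auto intro!: derivative_eq_intros simp: field_simps power2_eq_square)

lemma inverse_F_deriv: "r \<in> I \<Longrightarrow> ((\<lambda>r. 1 / F r) has_real_derivative - F1 r / (F r)\<^sup>2) (at r)"
  using F_nz[of r] by (auto intro!: derivative_eq_intros F_deriv simp: field_simps power2_eq_square)

lemma range_proj:
  assumes "p \<in> M"
  shows "range (proj p) = {v. (0, 0, snd (snd p)) \<bullet> v = 0}"
    and "proj p (proj p v) = proj p v"
proof -
  obtain t r \<omega> where p: "p = (t, r, \<omega>)" by (metis prod_cases3)
  have \<omega>: "\<omega> \<bullet> \<omega> = 1" using assms by (simp add: p M_def norm_eq_1)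
  have tang: "(0, 0, snd (snd p)) \<bullet> proj p v = 0" for v
    using \<omega> by (simp add: p proj_def split_beta inner_diff_right)
  have proj_eq: "proj p v = v" if "(0, 0, snd (snd p)) \<bullet> v = 0" for v
    using that by (simp add: p proj_def split_beta inner_prod_def)
  show "range (proj p) = {v. (0, 0, snd (snd p)) \<bullet> v = 0}"
  proof (intro equalityI subsetI)
    fix v assume "v \<in> {v :: 'd event. (0, 0, snd (snd p)) \<bullet> v = 0}"
    then show "v \<in> range (proj p)"
      using proj_eq[of v] by (intro range_eqI[of v "proj p" v]) simp
  qed (use tang in blast)
  show "proj p (proj p v) = proj p v"
    by (rule proj_eq[OF tang])
qed

lemma linear_proj: "linear (proj p)"
  by (rule linearI) (auto simp: proj_def split_beta algebra_simps inner_add_right)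

lemma bilinear_metric: "bounded_bilinear (metric p)"
  unfolding bilinear_conv_bounded_bilinear[symmetric] bilinear_def
  by (auto intro!: linearI simp: metric_def split_beta algebra_simps inner_add_right inner_add_left
      add_divide_distrib)

lemma bilinear_conn: "bounded_bilinear (conn p)"
  unfolding bilinear_conv_bounded_bilinear[symmetric] bilinear_def
  by (auto intro!: linearI simp: conn_def split_beta algebra_simps inner_add_right inner_add_left)

lemma linear_conn1: "linear (\<lambda>X. conn1 p X Y Z)" "linear (\<lambda>X. conn1 p Y X Z)"
  by (auto intro!: linearI simp: conn1_def split_beta algebra_simps inner_add_right inner_add_left
      add_divide_distrib diff_divide_distrib)

lemma metric_commute: "metric p X Y = metric p Y X"
  by (simp add: metric_def split_beta mult.commute inner_commute)

lemma conn_commute: "conn p X Y = conn p Y X"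
  by (simp add: conn_def split_beta mult.commute inner_commute add.commute)

lemma metric_nondegenerate:
  assumes p: "p \<in> M" and X: "X \<in> range (proj p)"
    and 0: "\<And>Y. Y \<in> range (proj p) \<Longrightarrow> metric p X Y = 0"
  shows "X = 0"
proof -
  obtain t r \<omega> where p_eq: "p = (t, r, \<omega>)" by (metis prod_cases3)
  obtain x y z where X_eq: "X = (x, y, z)" by (metis prod_cases3)
  have r: "r > 0" "F r \<noteq> 0"
    using p I_pos F_nz by (auto simp: p_eq M_def)
  \<comment> \<open>This test vector absorbs the sign and the size of the metric coefficients, so
    that pairing it with \<open>X\<close> gives a sum of squares.\<close>
  have "(- x / F r, F r * y, z) \<in> range (proj p)"
    using X range_proj(1)[OF p] by (simp add: X_eq p_eq)
  from 0[OF this] have *: "x\<^sup>2 + y\<^sup>2 + r\<^sup>2 * (z \<bullet> z) = 0"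
    using r by (simp add: metric_def p_eq X_eq power2_eq_square)
  then have "x\<^sup>2 = 0 \<and> y\<^sup>2 = 0 \<and> r\<^sup>2 * (z \<bullet> z) = 0"
    using zero_le_power2[of x] zero_le_power2[of y]
      mult_nonneg_nonneg[OF zero_le_power2[of r] inner_ge_zero[of z]] by linarith
  then show ?thesis
    using r by (simp add: X_eq zero_prod_def)
qed

lemma dim_range_proj:
  assumes "p \<in> M"
  shows "dim (range (proj p)) = CARD('d option)"
proof -
  have "(0, 0, snd (snd p)) \<noteq> (0 :: 'd event)"
    using assms by (auto simp: M_def zero_prod_def)
  then show ?thesis
    by (simp add: range_proj(1)[OF assms] dim_hyperplane)
qed

section \<open>Product rules for the connection and the metric along a map\<close>

context
  fixes \<phi> X Y :: "'a::real_normed_vector \<Rightarrow> 'd event" and D u X' Y'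
  assumes \<phi>: "(\<phi> has_derivative D) (at u)" and X: "(X has_derivative X') (at u)"
    and Y: "(Y has_derivative Y') (at u)" and M: "\<phi> u \<in> M"
begin

lemma in_I: "fst (snd (\<phi> u)) \<in> I"
  using M by (auto simp: M_def)

lemmas component_derivs =
  \<phi>[THEN has_derivative_fst] \<phi>[THEN has_derivative_snd, THEN has_derivative_fst]
  \<phi>[THEN has_derivative_snd, THEN has_derivative_snd]
  X[THEN has_derivative_fst] X[THEN has_derivative_snd, THEN has_derivative_fst]
  X[THEN has_derivative_snd, THEN has_derivative_snd]
  Y[THEN has_derivative_fst] Y[THEN has_derivative_snd, THEN has_derivative_fst]
  Y[THEN has_derivative_snd, THEN has_derivative_snd]

lemmas radial_deriv =
  DERIV_compose_FDERIV[OF _ \<phi>[THEN has_derivative_snd, THEN has_derivative_fst]]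

lemma conn_has_derivative:
  "((\<lambda>x. conn (\<phi> x) (X x) (Y x)) has_derivative
     (\<lambda>h. conn1 (\<phi> u) (D h) (X u) (Y u) + conn (\<phi> u) (X' h) (Y u) + conn (\<phi> u) (X u) (Y' h))) (at u)"
proof -
  \<comment> \<open>The derivative is stated in the shape in which the product rules produce it, so
    that they apply by matching; the comparison with \<open>conn1\<close> is then pure
    algebra.\<close>
  have "((\<lambda>x. conn (\<phi> x) (X x) (Y x)) has_derivative (\<lambda>h.
      (\<alpha> (fst (snd (\<phi> u))) * ((fst (X u) * fst (snd (Y' h)) + fst (X' h) * fst (snd (Y u)))
         + (fst (snd (X u)) * fst (Y' h) + fst (snd (X' h)) * fst (Y u)))
       + fst (snd (D h)) * \<alpha>1 (fst (snd (\<phi> u))) * (fst (X u) * fst (snd (Y u)) + fst (snd (X u)) * fst (Y u)),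
       (\<beta> (fst (snd (\<phi> u))) * (fst (X u) * fst (Y' h) + fst (X' h) * fst (Y u))
         + fst (snd (D h)) * \<beta>1 (fst (snd (\<phi> u))) * (fst (X u) * fst (Y u)))
       - (\<alpha> (fst (snd (\<phi> u))) * (fst (snd (X u)) * fst (snd (Y' h)) + fst (snd (X' h)) * fst (snd (Y u)))
         + fst (snd (D h)) * \<alpha>1 (fst (snd (\<phi> u))) * (fst (snd (X u)) * fst (snd (Y u))))
       - (\<gamma> (fst (snd (\<phi> u))) * (snd (snd (X u)) \<bullet> snd (snd (Y' h)) + snd (snd (X' h)) \<bullet> snd (snd (Y u)))
         + fst (snd (D h)) * \<gamma>1 (fst (snd (\<phi> u))) * (snd (snd (X u)) \<bullet> snd (snd (Y u)))),
       (inverse (fst (snd (\<phi> u))) *\<^sub>R ((fst (snd (X u)) *\<^sub>R snd (snd (Y' h)) + fst (snd (X' h)) *\<^sub>R snd (snd (Y u)))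
           + (fst (snd (Y u)) *\<^sub>R snd (snd (X' h)) + fst (snd (Y' h)) *\<^sub>R snd (snd (X u))))
         + (fst (snd (D h)) * (- 1 / (fst (snd (\<phi> u)))\<^sup>2)) *\<^sub>R
           (fst (snd (X u)) *\<^sub>R snd (snd (Y u)) + fst (snd (Y u)) *\<^sub>R snd (snd (X u))))
       + ((snd (snd (X u)) \<bullet> snd (snd (Y u))) *\<^sub>R snd (snd (D h))
         + (snd (snd (X u)) \<bullet> snd (snd (Y' h)) + snd (snd (X' h)) \<bullet> snd (snd (Y u))) *\<^sub>R snd (snd (\<phi> u)))))) (at u)"
    unfolding conn_def split_beta
    by (intro has_derivative_Pair has_derivative_add has_derivative_diff has_derivative_mult
        has_derivative_scaleR has_derivative_inner component_derivs radial_deriv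
        \<alpha>_deriv \<beta>_deriv \<gamma>_deriv inverse_deriv in_I)
  then show ?thesis
    by (rule has_derivative_eq_rhs)
      (auto simp: fun_eq_iff conn_def conn1_def split_beta algebra_simps inner_commute)
qed

text \<open>Metric compatibility. Tangency of \<open>X u\<close> and \<open>Y u\<close> makes the
  normal term of \<open>conn\<close>, a multiple of \<open>\<omega>\<close>, drop out of the inner
  products.\<close>

lemma metric_has_derivative:
  assumes "X u \<in> range (proj (\<phi> u))" "Y u \<in> range (proj (\<phi> u))"
  shows "((\<lambda>x. metric (\<phi> x) (X x) (Y x)) has_derivative
     (\<lambda>h. metric (\<phi> u) (X' h + conn (\<phi> u) (D h) (X u)) (Y u)
        + metric (\<phi> u) (X u) (Y' h + conn (\<phi> u) (D h) (Y u)))) (at u)"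
proof -
  have r: "fst (snd (\<phi> u)) > 0" "F (fst (snd (\<phi> u))) \<noteq> 0"
    using in_I I_pos F_nz by auto
  have tang: "snd (snd (\<phi> u)) \<bullet> snd (snd (X u)) = 0" "snd (snd (\<phi> u)) \<bullet> snd (snd (Y u)) = 0"
    using assms by (simp_all add: range_proj(1)[OF M] inner_prod_def)
  have "((\<lambda>x. metric (\<phi> x) (X x) (Y x)) has_derivative (\<lambda>h.
      (- F (fst (snd (\<phi> u))) * (fst (X u) * fst (Y' h) + fst (X' h) * fst (Y u))
       + (- (fst (snd (D h)) * F1 (fst (snd (\<phi> u))))) * (fst (X u) * fst (Y u)))
      + (1 / F (fst (snd (\<phi> u))) * (fst (snd (X u)) * fst (snd (Y' h)) + fst (snd (X' h)) * fst (snd (Y u)))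
       + fst (snd (D h)) * (- F1 (fst (snd (\<phi> u))) / (F (fst (snd (\<phi> u))))\<^sup>2) * (fst (snd (X u)) * fst (snd (Y u))))
      + (fst (snd (\<phi> u)) * fst (snd (\<phi> u)) * (snd (snd (X u)) \<bullet> snd (snd (Y' h)) + snd (snd (X' h)) \<bullet> snd (snd (Y u)))
       + (fst (snd (\<phi> u)) * fst (snd (D h)) + fst (snd (D h)) * fst (snd (\<phi> u))) * (snd (snd (X u)) \<bullet> snd (snd (Y u)))))) (at u)"
    unfolding metric_def split_beta power2_eq_square[of "fst (snd (\<phi> _))"]
    by (intro has_derivative_add has_derivative_minus has_derivative_mult
        has_derivative_inner component_derivs radial_deriv F_deriv inverse_F_deriv in_I)
  then show ?thesis
    by (rule has_derivative_eq_rhs)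
      (use r tang in \<open>auto simp: fun_eq_iff metric_def conn_def \<alpha>_def \<beta>_def \<gamma>_def split_beta
        inner_add_left inner_add_right inner_commute field_simps power2_eq_square\<close>)
qed

end

section \<open>The Ricci tensor and the field equations\<close>

text \<open>Splitting the product space twice reduces the trace to the t-, r- and sphere blocks. The
  two coefficients on the right are the expressions whose vanishing is the pair of differential
  equations for \<open>F\<close>.\<close>

lemma trace_curvature:
  assumes p: "(t, r, \<omega>) \<in> M" and y\<omega>: "\<omega> \<bullet> y\<^sub>\<omega> = 0" and z\<omega>: "\<omega> \<bullet> z\<^sub>\<omega> = 0"
  shows "(\<Sum>b\<in>Basis. connection_curvature conn conn1 (t, r, \<omega>) (proj (t, r, \<omega>) b)
      (y\<^sub>t, y\<^sub>r, y\<^sub>\<omega>) (z\<^sub>t, z\<^sub>r, z\<^sub>\<omega>) \<bullet> b)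
    = 1/2 * (F2 r + (real CARD('d) - 1) * F1 r / r) * (F r * y\<^sub>t * z\<^sub>t - y\<^sub>r * z\<^sub>r / F r)
      + ((real CARD('d) - 2) * (1 - F r) - r * F1 r) * (y\<^sub>\<omega> \<bullet> z\<^sub>\<omega>)" (is "?lhs = ?rhs")
proof -
  let ?R = "\<lambda>x. connection_curvature conn conn1 (t, r, \<omega>) x (y\<^sub>t, y\<^sub>r, y\<^sub>\<omega>) (z\<^sub>t, z\<^sub>r, z\<^sub>\<omega>)"
  have r: "r > 0" "F r \<noteq> 0" and \<omega>: "\<omega> \<bullet> \<omega> = 1"
    using p I_pos F_nz by (auto simp: M_def norm_eq_1)
  \<comment> \<open>The coefficient of \<open>x\<close> in the sphere block: a contribution of the
    unit sphere plus the r-component of \<open>conn\<close> on the two fixed vectors, divided by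
    \<open>r\<close>.\<close>
  define K where "K = y\<^sub>\<omega> \<bullet> z\<^sub>\<omega> + (\<beta> r * (y\<^sub>t * z\<^sub>t) - \<alpha> r * (y\<^sub>r * z\<^sub>r) - \<gamma> r * (y\<^sub>\<omega> \<bullet> z\<^sub>\<omega>)) / r"
  have Rt: "fst (?R (1, 0, 0)) = - (\<alpha>1 r + 2 * (\<alpha> r)\<^sup>2) * (y\<^sub>r * z\<^sub>r) - \<alpha> r * \<gamma> r * (y\<^sub>\<omega> \<bullet> z\<^sub>\<omega>)"
    by (simp add: connection_curvature_def conn_def conn1_def algebra_simps power2_eq_square)
  have Rr: "fst (snd (?R (0, 1, 0)))
      = (\<beta>1 r - 2 * \<alpha> r * \<beta> r) * (y\<^sub>t * z\<^sub>t) - (\<gamma>1 r - \<alpha> r * \<gamma> r - \<gamma> r / r) * (y\<^sub>\<omega> \<bullet> z\<^sub>\<omega>)"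
    by (simp add: connection_curvature_def conn_def conn1_def algebra_simps divide_inverse)
  have R\<omega>: "snd (snd (?R (0, 0, x))) = K *\<^sub>R x + ((F r - 1) * (x \<bullet> z\<^sub>\<omega>)) *\<^sub>R y\<^sub>\<omega>"
    if x: "\<omega> \<bullet> x = 0" for x
  \<comment> \<open>Testing against an arbitrary \<open>w\<close> turns the vector identity into one
    of real numbers, where \<open>field_simps\<close> works.\<close>
  proof (rule vector_eq_rdot[THEN iffD1, rule_format])
    fix w
    have "x \<bullet> \<omega> = 0" "y\<^sub>\<omega> \<bullet> \<omega> = 0"
      using x y\<omega> by (simp_all add: inner_commute)
    then show "snd (snd (?R (0, 0, x))) \<bullet> w = (K *\<^sub>R x + ((F r - 1) * (x \<bullet> z\<^sub>\<omega>)) *\<^sub>R y\<^sub>\<omega>) \<bullet> w"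
      using r
      by (simp add: connection_curvature_def conn_def conn1_def K_def \<gamma>_def inner_add_left
          inner_add_right inner_diff_left inner_commute[of y\<^sub>\<omega> x] field_simps power2_eq_square)
  qed
  have "(\<Sum>b\<in>Basis. snd (snd (?R (proj (t, r, \<omega>) (0, 0, b)))) \<bullet> b)
      = (\<Sum>b\<in>Basis. K * (1 - (\<omega> \<bullet> b) * (\<omega> \<bullet> b)) + (F r - 1) * ((y\<^sub>\<omega> \<bullet> b) * (z\<^sub>\<omega> \<bullet> b)))"
  proof (rule sum.cong[OF refl])
    fix b :: "real ^ 'd" assume "b \<in> Basis"
    then show "snd (snd (?R (proj (t, r, \<omega>) (0, 0, b)))) \<bullet> b
        = K * (1 - (\<omega> \<bullet> b) * (\<omega> \<bullet> b)) + (F r - 1) * ((y\<^sub>\<omega> \<bullet> b) * (z\<^sub>\<omega> \<bullet> b))"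
      using R\<omega>[of "b - (\<omega> \<bullet> b) *\<^sub>R \<omega>"] \<omega> z\<omega>
      by (simp add: proj_def inner_diff_left inner_diff_right inner_add_left inner_commute[of b z\<^sub>\<omega>])
  qed
  \<comment> \<open>The projection onto the complement of \<open>\<omega>\<close> has trace d - 1,
    which appears here as \<open>real CARD('d) - \<omega> \<bullet> \<omega>\<close>.\<close>
  also have "\<dots> = K * (real CARD('d) - \<omega> \<bullet> \<omega>) + (F r - 1) * (y\<^sub>\<omega> \<bullet> z\<^sub>\<omega>)"
    by (simp add: sum.distrib sum_subtractf sum_distrib_left[symmetric] euclidean_inner[symmetric])
  finally have "?lhs = fst (?R (1, 0, 0)) + fst (snd (?R (0, 1, 0)))
      + (K * (real CARD('d) - \<omega> \<bullet> \<omega>) + (F r - 1) * (y\<^sub>\<omega> \<bullet> z\<^sub>\<omega>))"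
    unfolding trace_prod[of "\<lambda>b. ?R (proj (t, r, \<omega>) b)"]
      trace_prod[of "\<lambda>b. snd (?R (proj (t, r, \<omega>) (0, b)))"]
    by (simp add: proj_def zero_prod_def)
  also have "\<dots> = ?rhs"
    unfolding Rt Rr \<omega> K_def \<alpha>_def \<alpha>1_def \<beta>_def \<beta>1_def \<gamma>_def \<gamma>1_def
    using r by (simp add: field_simps power2_eq_square)
  finally show ?thesis .
qed

text \<open>Every parametrization of \<open>M\<close> satisfies \<open>adapted_chart\<close>, so its
  Ricci tensor is the trace just computed, and the two equations annihilate both
  coefficients.\<close>

theorem ricci_flat_metric:
  assumes ode1: "\<And>r. r \<in> I \<Longrightarrow> F2 r + (real CARD('d) - 1) * F1 r / r = 0"
    and ode2: "\<And>r. r \<in> I \<Longrightarrow> (real CARD('d) - 2) * (1 - F r) = r * F1 r"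
  shows "ricci_flat TYPE('d option) M metric"
  unfolding ricci_flat_def
proof (intro conjI allI impI ballI)
  have "I \<subseteq> {0<..}" using I_pos by auto
  then show "smooth_submanifold TYPE('d option) M"
    using local_parametrization_sphere_polar[OF open_I, where 'd='d]
    unfolding smooth_submanifold_def M_def by blast
next
  fix U and \<phi> :: "real ^ 'd option \<Rightarrow> 'd event" and u i j
  assume par: "local_parametrization M U \<phi>" and u: "u \<in> U"
  let ?D = "\<lambda>u. frechet_derivative \<phi> (at u)" and ?N = "\<lambda>u. snd (snd (\<phi> u))"
  have U: "open U" and smooth: "smooth_map_on U \<phi>" and inj: "\<And>u. u \<in> U \<Longrightarrow> inj (?D u)"
    using par by (auto simp: local_parametrization_def)
  have M: "\<phi> u \<in> M" if "u \<in> U" for u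
    using par that by (auto simp: local_parametrization_def dest: openin_imp_subset)
  have unit: "?N u \<bullet> ?N u = 1" if "u \<in> U" for u
    using M[OF that] by (auto simp: M_def norm_eq_1)
  have D: "(\<phi> has_derivative ?D u) (at u)" if "u \<in> U" for u
    using smooth_map_on_has_derivative[OF smooth that] .
  have DD: "((\<lambda>x. ?D x h) has_derivative frechet_derivative (\<lambda>x. ?D x h) (at u)) (at u)" if "u \<in> U" for u h
    using smooth_map_on_has_derivative[OF smooth_map_on_frechet_derivative[OF smooth] that] .
  note N = D[THEN has_derivative_snd, THEN has_derivative_snd]
  \<comment> \<open>Differentiate |omega|^2 = 1 along the chart.\<close>
  have tangent: "?N u \<bullet> snd (snd (?D u h)) = 0" if "u \<in> U" for u h
  proof -
    have "((\<lambda>x. 1 :: real) has_derivative (\<lambda>h. ?N u \<bullet> snd (snd (?D u h)) + snd (snd (?D u h)) \<bullet> ?N u)) (at u)"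
      by (rule has_derivative_transform_within_open[OF has_derivative_inner[OF N[OF that] N[OF that]] U that])
        (rule unit)
    from fun_cong[OF has_derivative_unique[OF this has_derivative_const], of h]
    show ?thesis by (simp add: inner_commute)
  qed
  \<comment> \<open>Differentiating the previous identity again shows that the normal part of a
    second derivative is exactly what the normal term of \<open>conn\<close> compensates.\<close>
  have tangent2: "?N u \<bullet> snd (snd (frechet_derivative (\<lambda>x. ?D x h) (at u) k))
      + snd (snd (?D u k)) \<bullet> snd (snd (?D u h)) = 0" if "u \<in> U" for u h k
  proof -
    note D2 = DD[OF that, of h, THEN has_derivative_snd, THEN has_derivative_snd]
    have "((\<lambda>x. 0 :: real) has_derivative (\<lambda>k. ?N u \<bullet> snd (snd (frechet_derivative (\<lambda>x. ?D x h) (at u) k))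
        + snd (snd (?D u k)) \<bullet> snd (snd (?D u h)))) (at u)"
      by (rule has_derivative_transform_within_open[OF has_derivative_inner[OF N[OF that] D2] U that])
        (rule tangent)
    from fun_cong[OF has_derivative_unique[OF this has_derivative_const], of k]
    show ?thesis .
  qed
  interpret adapted_chart U \<phi> metric proj conn conn1
  proof (rule adapted_chart.intro)
    fix u h k assume u: "u \<in> U"
    show "?D u h \<in> range (proj (\<phi> u))"
      using tangent[OF u] by (simp add: range_proj(1)[OF M[OF u]] inner_prod_def)
    show "frechet_derivative (\<lambda>x. ?D x h) (at u) k + conn (\<phi> u) (?D u k) (?D u h) \<in> range (proj (\<phi> u))"
      using tangent2[OF u, of h k] tangent[OF u] unit[OF u]
      by (simp add: range_proj(1)[OF M[OF u]] inner_prod_def conn_def split_beta inner_add_right)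
  qed (assumption | rule U smooth inj linear_proj range_proj(2) dim_range_proj bilinear_metric
      metric_commute metric_nondegenerate bilinear_conn conn_commute conn_has_derivative
      metric_has_derivative linear_conn1 M D)+
  obtain t r \<omega> y\<^sub>t y\<^sub>r y\<^sub>\<omega> z\<^sub>t z\<^sub>r z\<^sub>\<omega> where eq: "\<phi> u = (t, r, \<omega>)" "e j u = (y\<^sub>t, y\<^sub>r, y\<^sub>\<omega>)" "e i u = (z\<^sub>t, z\<^sub>r, z\<^sub>\<omega>)"
    by (metis prod_cases3)
  have "\<omega> \<bullet> y\<^sub>\<omega> = 0" "\<omega> \<bullet> z\<^sub>\<omega> = 0"
    using e_tangent[OF u, of i] e_tangent[OF u, of j]
    unfolding range_proj(1)[OF M[OF u]] by (simp_all add: eq)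
  moreover have "(t, r, \<omega>) \<in> M" "r \<in> I"
    using M[OF u] by (auto simp: eq M_def)
  ultimately show "ricci (coord_metric \<phi> metric) i j u = 0"
    unfolding ricci_eq_trace[OF u] eq
    by (subst trace_curvature) (auto simp: ode1 ode2)
qed

end

section \<open>The Tangherlini metric\<close>

lemma has_real_derivative_divide_power:
  fixes c r :: real
  assumes "r \<noteq> 0"
  shows "((\<lambda>r. c / r ^ k) has_real_derivative - (k * c / r ^ (k + 1))) (at r)"
\<comment> \<open>The split removes the truncated exponent \<open>k - 1\<close>; for exponent 0 the
  function is constant.\<close>
proof (cases k)
  case (Suc m)
  have "((\<lambda>r. c / r ^ k) has_real_derivative (0 * r ^ k - c * (k * r ^ (k - 1))) / (r ^ k * r ^ k)) (at r)"
    using assms by (intro DERIV_divide DERIV_const) (auto intro!: derivative_eq_intros)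
  then show ?thesis
    using assms by (simp add: Suc mult.commute)
qed simp

theorem mainTheorem1:
  fixes \<mu> :: real
  assumes "CARD('d::finite) \<ge> 3" and "\<mu> > 0"
  shows "ricci_flat TYPE('d option) (tangherlini_manifold \<mu> :: (real \<times> real \<times> (real ^ 'd)) set)
           (tangherlini_metric \<mu>)"
proof -
  define n where "n = CARD('d) - 2"
  have n: "real CARD('d) = real n + 2"
    using assms(1) by (simp add: n_def)
  let ?F = "\<lambda>r. 1 - \<mu> / r ^ n" and ?F1 = "\<lambda>r. n * \<mu> / r ^ (n + 1)"
    and ?F2 = "\<lambda>r. - (n * (n + 1) * \<mu> / r ^ (n + 2))" and ?I = "{r. r > 0 \<and> r ^ n \<noteq> \<mu>}"
  interpret static_spherical ?F ?F1 ?F2 ?I "TYPE('d)"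
  proof
    have "open ({0<..} \<inter> (\<lambda>r. r ^ n) -` (- {\<mu>}))"
      by (intro open_Int open_vimage continuous_intros)
    moreover have "{0<..} \<inter> (\<lambda>r. r ^ n) -` (- {\<mu>}) = ?I"
      by auto
    ultimately show "open ?I"
      by simp
  next
    fix r assume "r \<in> ?I"
    then have r: "r > 0" "r ^ n \<noteq> \<mu>" by auto
    show "r > 0" by (fact r)
    show "?F r \<noteq> 0" using r by simp
    show "(?F has_real_derivative ?F1 r) (at r)"
      using DERIV_diff[OF DERIV_const[of 1] has_real_derivative_divide_power[of r \<mu> n]] r by simp
    show "(?F1 has_real_derivative ?F2 r) (at r)"
      using has_real_derivative_divide_power[of r "n * \<mu>" "n + 1"] r by (simp add: algebra_simps)
  qed
  \<comment> \<open>As d - 1 = n + 1, \<open>?F2 r\<close> cancels (n + 1) \<open>?F1 r\<close> / r;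
    as d - 2 = n, both sides of the second equation equal n \<mu> / r^n.\<close>
  have "ricci_flat TYPE('d option) M metric"
    by (rule ricci_flat_metric) (auto simp: n field_simps)
  also have "M = tangherlini_manifold \<mu>"
    unfolding M_def unfolding tangherlini_manifold_def n_def by auto
  also have "metric = tangherlini_metric \<mu>"
    unfolding metric_def unfolding tangherlini_metric_def round_metric_def n_def ..
  finally show ?thesis .
qed

end
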